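(* Let $\bm F\in\mathbb R^{n\times m}$ and $Z\subseteq\{0,1\}^n$, and let $X_{\bm F,Z}$, the exact decision diagram $\mathcal D=(N,A,\bm\nu,\bm u)$ for $X_{\bm F,Z}$ and the set $R_{\bm F,Z}$ be as defined in the context. Assume that, for all $\bm c,\bm d\in\mathbb R^n$, the problem $$\min\{\bm d^\top\bm x+\bm c^\top\bm z+\|\bm F^\top\bm x\|_2^2:\ \bm x\in\mathbb R^n,\ \bm z\in Z,\ \bm x\circ(\bm 1-\bm z)=\bm 0\}$$ is not unbounded if and only if there exists $\bm\delta\in\mathbb R^m$ with $\bm F\bm\delta=\bm d$. Then $$\mathrm{cl\,conv}(X_{\bm F,Z})=\mathrm{proj}_{(x_0,\bm x,\bm z)}R_{\bm F,Z}.$$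
   Context: $\circ$ is the entrywise product; $[i:j]=\{i,\dots,j\}$; $\bm F_{[\ell:n]}$ is the submatrix of rows $\ell,\dots,n$; $\bm H_\downarrow$ is $\bm H$ with its first row deleted; $\bm e_i$ is the $i$-th unit vector. $$X_{\bm F,Z}=\{(x_0,\bm x,\bm z)\in\mathbb R\times\mathbb R^n\times Z:\ \|\bm F^\top\bm x\|_2^2\le x_0,\ \bm x\circ(\bm 1-\bm z)=\bm 0\}.$$ Completion sets. For $\bm v\in\{0,1\}^{\ell-1}$, $Z^\ell(\bm v)=\{\bm w\in\{0,1\}^{n+1-\ell}:(\bm v,\bm w)\in Z\}$. Dynamic programming representation of $Z$ (assumed given). Every partial solution $\bm v\in\{0,1\}^{\ell-1}$ with $Z^\ell(\bm v)\ne\emptyset$ has a state $\rho^\ell(\bm v)$ such that partial solutions with the same state have the same completion set, and there is an update function $\psi$ with $\rho^{\ell+1}((\bm v,\bar z))=\psi(\rho^\ell(\bm v),\bar z)$. A decision $\bar z\in\{0,1\}$ at a state $\rho^\ell(\bm v)$ is infeasible if $Z^{\ell+1}((\bm v,\bar z))=\emptyset$. Exact decision diagram. It is a layered directed multigraph with layers $1,\dots,n+1$. Layer 1 contains only the root state $s^1=(\rho^1,\bm F)$. A node of layer $\ell$ is a state $(\rho,\bm H)$ with $\bm H\in\mathbb R^{(n+1-\ell)\times m}$; identical states in the same layer are the same node. For each node $(\rho,\bm H)$ of layer $\ell\le n$ and each feasible decision $\bar z\in\{0,1\}$ there is one arc $a$ with tail $t_a=(\rho,\bm H)$, layer $\ell(a)=\ell$,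 value $\nu_a=\bar z$, and, where $\bm u^\top$ denotes the first row of $\bm H$: - if $\bar z=0$, or $\bar z=1$ and $\bm u=\bm 0$: head $h_a=(\psi(\rho,\bar z),\bm H_\downarrow)$ and transition vector $\bm u_a=\bm 0$; - if $\bar z=1$ and $\bm u\ne\bm 0$: head $h_a=(\psi(\rho,\bar z),\bm H_\downarrow(\bm I-\bm u\bm u^\top/\|\bm u\|_2^2))$ and transition vector $\bm u_a=\bm u/\|\bm u\|_2$. Infeasible decisions generate no arcs. $N$ and $A$ are the nodes and arcs generated from the root; $\ell(v)$ is the layer of node $v$. The set $R_{\bm F,Z}\subseteq\mathbb R^{1+2n+2|A|}$ consists of all $(x_0,\bm x,\bm z,\bm w,\bm r)$ with $\bm w,\bm r\in\mathbb R^A$ satisfying $$x_0\ge\sum_{a\in A}\frac{w_a^2}{r_a},\quad \bm F^\top\bm x=\sum_{a\in A}\bm u_aw_a,\quad \bm z=\sum_{a\in A:\nu_a=1}\bm e_{\ell(a)}r_a,$$ $$\sum_{a:h_a=v}r_a=\sum_{a:t_a=v}r_a\ \ \forall v\in N \text{ with } 2\le\ell(v)\le n,\quad \sum_{a:\ell(a)=1}r_a=1,\quad \sum_{a:\ell(a)=n}r_a=1,\quad \bm r\ge\bm 0,$$ where $w_a^2/r_a:=0$ if $w_a=r_a=0$ and $:=+\infty$ if $r_a=0\ne w_a$. *)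

theory Defs
  imports "HOL-Analysis.Analysis"
begin

(* Coordinates of R^n are indexed by a finite linearly ordered type 'n; the l-th coordinate
   (1 <= l <= n) is the l-th smallest element of 'n.  A matrix F in R^(n x m) has type
   real^'m^'n, so "coords F" is the list of its rows. *)

definition coords :: "'a^'n::{finite,linorder} \<Rightarrow> 'a list" where
  "coords x = map (\<lambda>i. x $ i) (sorted_list_of_set UNIV)"

definition index :: "nat \<Rightarrow> 'n::{finite,linorder}" where
  "index l = sorted_list_of_set UNIV ! (l - 1)"

definition feasible_pairs :: "(real^'n::finite) set \<Rightarrow> ((real^'n) \<times> (real^'n)) set" where
  "feasible_pairs Z = {(x, z). z \<in> Z \<and> (\<forall>i. x $ i * (1 - z $ i) = 0)}"

definition X_set :: "real^'m^'n \<Rightarrow> (real^'n) set \<Rightarrow> (real \<times> (real^'n::finite) \<times> (real^'n)) set" where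
  "X_set F Z = {(x0, x, z). (norm (transpose F *v x))\<^sup>2 \<le> x0 \<and> (x, z) \<in> feasible_pairs Z}"


(* Partial solutions and decisions are 0/1-valued; they are written as Booleans, False for 0 and
   True for 1. *)

definition completions :: "(real^'n::{finite,linorder}) set \<Rightarrow> nat \<Rightarrow> bool list \<Rightarrow> bool list set" where
  "completions Z l v =
     {w. length w = CARD('n) + 1 - l \<and> (\<exists>z\<in>Z. coords z = map of_bool (v @ w))}"

(* States are only meaningful for partial solutions that have a completion, so both conditions
   are imposed on such partial solutions only. *)

definition dp_representation ::
  "(real^'n::{finite,linorder}) set \<Rightarrow> (nat \<Rightarrow> bool list \<Rightarrow> 's) \<Rightarrow> ('s \<Rightarrow> bool \<Rightarrow> 's) \<Rightarrow> bool" where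
  "dp_representation Z \<rho> \<psi> \<longleftrightarrow>
     (\<forall>l\<in>{1..CARD('n) + 1}. \<forall>v v'. length v = l - 1 \<longrightarrow> length v' = l - 1 \<longrightarrow>
        completions Z l v \<noteq> {} \<longrightarrow> completions Z l v' \<noteq> {} \<longrightarrow> \<rho> l v = \<rho> l v' \<longrightarrow>
        completions Z l v = completions Z l v') \<and>
     (\<forall>l\<in>{1..CARD('n)}. \<forall>v b. length v = l - 1 \<longrightarrow> completions Z (l + 1) (v @ [b]) \<noteq> {} \<longrightarrow>
        \<rho> (l + 1) (v @ [b]) = \<psi> (\<rho> l v) b)"

(* Under dp_representation the choice of the partial solution v with state s is immaterial. *)

definition feasible_decision ::
  "(real^'n::{finite,linorder}) set \<Rightarrow> (nat \<Rightarrow> bool list \<Rightarrow> 's) \<Rightarrow> nat \<Rightarrow> 's \<Rightarrow> bool \<Rightarrow> bool" where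
  "feasible_decision Z \<rho> l s b \<longleftrightarrow>
     (\<exists>v. length v = l - 1 \<and> completions Z l v \<noteq> {} \<and> \<rho> l v = s \<and>
          completions Z (l + 1) (v @ [b]) \<noteq> {})"


(* A node carries its layer l, so that equal states are identified only within a layer.  The
   second component H of a state (rho, H) is the list of its n + 1 - l rows, with entries in R^m:
   the first row is hd H and deleting it gives tl H.  There is at most one arc per tail and
   value, so an arc is given by these two; its head and transition vector are functions of it. *)

datatype ('s, 'h) dd_node = Node (layer: nat) (state: 's) (rows: "'h list")

datatype ('s, 'h) dd_arc = Arc (tail: "('s, 'h) dd_node") (val: bool)

definition projector :: "real^'m \<Rightarrow> real^'m^'m" where
  "projector u = mat 1 - (\<chi> i j. u $ i * u $ j / (norm u)\<^sup>2)"

definition head :: "('s \<Rightarrow> bool \<Rightarrow> 's) \<Rightarrow> ('s, real^'m) dd_arc \<Rightarrow> ('s, real^'m) dd_node" where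
  "head \<psi> a =
     (let N = tail a; b = val a; u = hd (rows N); H = tl (rows N)
      in Node (layer N + 1) (\<psi> (state N) b)
           (if b \<and> u \<noteq> 0 then map (\<lambda>h. h v* projector u) H else H))"

definition transition :: "('s, real^'m) dd_arc \<Rightarrow> real^'m" where
  "transition a =
     (let u = hd (rows (tail a)) in if val a \<and> u \<noteq> 0 then u /\<^sub>R norm u else 0)"

inductive_set dd_nodes ::
  "real^'m^'n::{finite,linorder} \<Rightarrow> (real^'n::{finite,linorder}) set \<Rightarrow> (nat \<Rightarrow> bool list \<Rightarrow> 's) \<Rightarrow>
   ('s \<Rightarrow> bool \<Rightarrow> 's) \<Rightarrow> ('s, real^'m) dd_node set"
  for F Z \<rho> \<psi> where
  root: "Node 1 (\<rho> 1 []) (coords F) \<in> dd_nodes F Z \<rho> \<psi>"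
| step: "N \<in> dd_nodes F Z \<rho> \<psi> \<Longrightarrow> layer N \<le> CARD('n) \<Longrightarrow>
         feasible_decision Z \<rho> (layer N) (state N) b \<Longrightarrow> head \<psi> (Arc N b) \<in> dd_nodes F Z \<rho> \<psi>"

definition dd_arcs ::
  "real^'m^'n::{finite,linorder} \<Rightarrow> (real^'n::{finite,linorder}) set \<Rightarrow> (nat \<Rightarrow> bool list \<Rightarrow> 's) \<Rightarrow>
   ('s \<Rightarrow> bool \<Rightarrow> 's) \<Rightarrow> ('s, real^'m) dd_arc set" where
  "dd_arcs F Z \<rho> \<psi> =
     {Arc N b | N b. N \<in> dd_nodes F Z \<rho> \<psi> \<and> layer N \<le> CARD('n) \<and>
        feasible_decision Z \<rho> (layer N) (state N) b}"

(* The diagram is finite, so sums over its arcs are genuine sums. *)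

lemma finite_dd_nodes: "finite (dd_nodes F Z \<rho> \<psi>)"
  for F :: "real^'m^'n::{finite,linorder}"
proof -
  define root where "root = Node 1 (\<rho> 1 []) (coords F)"
  define L where "L k = ((\<lambda>S. \<Union>b. (\<lambda>N. head \<psi> (Arc N b)) ` S) ^^ k) {root}" for k
  have L_Suc: "L (Suc k) = (\<Union>b. (\<lambda>N. head \<psi> (Arc N b)) ` L k)" for k
    by (simp add: L_def)
  have fin: "finite (L k)" for k
    by (induction k) (auto simp: L_Suc, simp add: L_def)
  have "\<exists>k\<le>CARD('n). layer N = k + 1 \<and> N \<in> L k" if "N \<in> dd_nodes F Z \<rho> \<psi>" for N
    using that
  proof induction
    case root
    then show ?case by (intro exI[of _ 0]) (simp add: L_def root_def)
  next
    case (step N b)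
    then obtain k where k: "layer N = k + 1" "N \<in> L k" by blast
    have "layer (head \<psi> (Arc N b)) = Suc k + 1" using k by (simp add: head_def Let_def)
    moreover have "head \<psi> (Arc N b) \<in> L (Suc k)" using k unfolding L_Suc by blast
    moreover have "Suc k \<le> CARD('n)" using step k by simp
    ultimately show ?case by blast
  qed
  then have "dd_nodes F Z \<rho> \<psi> \<subseteq> (\<Union>k\<le>CARD('n). L k)" by blast
  then show ?thesis using fin by (meson finite_UN_I finite_atMost finite_subset)
qed

lemma finite_dd_arcs: "finite (dd_arcs F Z \<rho> \<psi>)"
proof -
  have "dd_arcs F Z \<rho> \<psi> \<subseteq> (\<lambda>(N, b). Arc N b) ` (dd_nodes F Z \<rho> \<psi> \<times> UNIV)"
    by (auto simp: dd_arcs_def)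
  then show ?thesis using finite_dd_nodes by (meson finite_SigmaI finite_imageI finite_subset finite)
qed


definition quad_over_lin :: "real \<Rightarrow> real \<Rightarrow> ereal" where
  "quad_over_lin w r = (if r = 0 then (if w = 0 then 0 else \<infinity>) else ereal (w\<^sup>2 / r))"

(* Vectors in R^A are functions that are undefined outside A. *)

definition R_set ::
  "real^'m^'n::{finite,linorder} \<Rightarrow> (real^'n::{finite,linorder}) set \<Rightarrow> (nat \<Rightarrow> bool list \<Rightarrow> 's) \<Rightarrow>
   ('s \<Rightarrow> bool \<Rightarrow> 's) \<Rightarrow>
   (real \<times> (real^'n::{finite,linorder}) \<times> (real^'n::{finite,linorder}) \<times> (('s, real^'m) dd_arc \<Rightarrow> real) \<times> (('s, real^'m) dd_arc \<Rightarrow> real)) set"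
  where
  "R_set F Z \<rho> \<psi> = (let A = dd_arcs F Z \<rho> \<psi> in
     {(x0, x, z, w, r). w \<in> extensional A \<and> r \<in> extensional A \<and>
        ereal x0 \<ge> (\<Sum>a\<in>A. quad_over_lin (w a) (r a)) \<and>
        transpose F *v x = (\<Sum>a\<in>A. w a *\<^sub>R transition a) \<and>
        z = (\<Sum>a\<in>{a\<in>A. val a}. r a *\<^sub>R axis (index (layer (tail a))) 1) \<and>
        (\<forall>N\<in>dd_nodes F Z \<rho> \<psi>. 2 \<le> layer N \<and> layer N \<le> CARD('n) \<longrightarrow>
           (\<Sum>a\<in>{a\<in>A. head \<psi> a = N}. r a) = (\<Sum>a\<in>{a\<in>A. tail a = N}. r a)) \<and>
        (\<Sum>a\<in>{a\<in>A. layer (tail a) = 1}. r a) = 1 \<and>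
        (\<Sum>a\<in>{a\<in>A. layer (tail a) = CARD('n)}. r a) = 1 \<and>
        (\<forall>a\<in>A. r a \<ge> 0)})"

end

theory Submission imports Defs
begin

text \<open>The vectors along a path come from the Gram--Schmidt process applied to the rows of \<open>F\<close>
  selected by the path, so they are orthonormal or zero and span the image under the transpose of
  \<open>F\<close> of the vectors supported on the selected coordinates. A point of the mixed-integer set is
  therefore represented by the indicator of its path. As the relaxation is convex, and closed
  because flows and, for bounded \<open>x\<^sub>0\<close>, the \<open>w\<close> are bounded, one inclusion follows.

  Conversely, a unit flow is a convex combination of paths, and taking \<open>w / r\<close> as coefficients on
  every path yields a convex combination of points of the mixed-integer set with the same image
  under the transpose of \<open>F\<close> and cost \<open>\<Sum>w\<^sup>2 / r\<close>. The two \<open>x\<close> differ by a vector of the kernel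
  of the transpose. By duality, the boundedness assumption says that this kernel is spanned by its
  vectors supported on the support of some element of \<open>Z\<close>, and these are recession directions of
  the closed convex hull.\<close>

section \<open>Regrouping finite sums over arcs\<close>

lemma sum_of_bool_image:
  fixes g :: "'a \<Rightarrow> 'b::real_vector"
  assumes "finite A" "inj_on P K" "P ` K \<subseteq> A"
  shows "(\<Sum>a\<in>A. of_bool (a \<in> P ` K) *\<^sub>R g a) = (\<Sum>k\<in>K. g (P k))"
proof -
  have "(\<Sum>a\<in>A. of_bool (a \<in> P ` K) *\<^sub>R g a) = (\<Sum>a\<in>P ` K. g a)"
    using assms by (intro sum.mono_neutral_cong_right) auto
  then show ?thesis using assms(2) by (simp add: sum.reindex)
qed

lemma sum_split_by:
  fixes f :: "'a \<Rightarrow> 'b::comm_monoid_add"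
  assumes "finite A" "finite V" "\<And>a. a \<in> A \<Longrightarrow> P a \<longleftrightarrow> h a \<in> V"
  shows "(\<Sum>N\<in>V. \<Sum>a\<in>{a\<in>A. h a = N}. f a) = (\<Sum>a\<in>{a\<in>A. P a}. f a)"
proof -
  have "(\<Sum>a\<in>{a\<in>A. P a}. f a) = (\<Sum>N\<in>V. \<Sum>a\<in>{a\<in>{a\<in>A. P a}. h a = N}. f a)"
    using assms by (intro sum.group[symmetric]) auto
  also have "\<dots> = (\<Sum>N\<in>V. \<Sum>a\<in>{a\<in>A. h a = N}. f a)"
    using assms(3) by (intro sum.cong) auto
  finally show ?thesis by simp
qed

subsection \<open>Unit flows in layered graphs\<close>

text \<open>An abstraction of the diagram that forgets states and transition vectors, so that
  decomposing a unit flow becomes an argument about layers alone.\<close>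

locale layered_flow =
  fixes A :: "'a set" and V :: "'v set" and src dst :: "'a \<Rightarrow> 'v" and lay :: "'v \<Rightarrow> nat"
    and n :: nat and r :: "'a \<Rightarrow> real"
  assumes finite_A: "finite A" and finite_V: "finite V"
    and tl_V: "a \<in> A \<Longrightarrow> src a \<in> V" and hd_V: "a \<in> A \<Longrightarrow> dst a \<in> V"
    and lay_hd: "a \<in> A \<Longrightarrow> lay (dst a) = Suc (lay (src a))"
    and lay_tl: "a \<in> A \<Longrightarrow> 1 \<le> lay (src a) \<and> lay (src a) \<le> n"
    and r_nonneg: "a \<in> A \<Longrightarrow> 0 \<le> r a"
    and conservation: "N \<in> V \<Longrightarrow> 2 \<le> lay N \<Longrightarrow> lay N \<le> n \<Longrightarrow>
      (\<Sum>a\<in>{a\<in>A. dst a = N}. r a) = (\<Sum>a\<in>{a\<in>A. src a = N}. r a)"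
    and unit: "(\<Sum>a\<in>{a\<in>A. lay (src a) = 1}. r a) = 1"
begin

definition L where "L k = {N\<in>V. lay N = k}"

lemma finite_L: "finite (L k)"
  using finite_V by (simp add: L_def)

lemma sum_L_tl: "(\<Sum>N\<in>L k. \<Sum>a\<in>{a\<in>A. src a = N}. f a) = (\<Sum>a\<in>{a\<in>A. lay (src a) = k}. f a)"
  for f :: "'a \<Rightarrow> 'b::comm_monoid_add"
  by (rule sum_split_by) (auto simp: finite_A finite_V L_def tl_V)

lemma sum_L_hd: "(\<Sum>N\<in>L (Suc k). \<Sum>a\<in>{a\<in>A. dst a = N}. f a) = (\<Sum>a\<in>{a\<in>A. lay (src a) = k}. f a)"
  for f :: "'a \<Rightarrow> 'b::comm_monoid_add"
  by (rule sum_split_by) (auto simp: finite_A finite_V L_def hd_V lay_hd)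

text \<open>Grouping the arcs of a layer by tail, conservation replaces outflow by inflow, and the
  arcs entering a layer are those leaving the previous one. So the unit total is handed down from
  layer 1.\<close>

lemma layer_total:
  assumes "1 \<le> k" "k \<le> n"
  shows "(\<Sum>a\<in>{a\<in>A. lay (src a) = k}. r a) = 1"
  using assms
proof (induction k rule: dec_induct)
  case base
  then show ?case using unit by simp
next
  case (step k)
  have "(\<Sum>a\<in>{a\<in>A. lay (src a) = Suc k}. r a) = (\<Sum>N\<in>L (Suc k). \<Sum>a\<in>{a\<in>A. src a = N}. r a)"
    by (simp add: sum_L_tl)
  also have "\<dots> = (\<Sum>N\<in>L (Suc k). \<Sum>a\<in>{a\<in>A. dst a = N}. r a)"
    by (rule sum.cong) (use step in \<open>auto simp: conservation L_def\<close>)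
  also have "\<dots> = 1" using step by (simp add: sum_L_hd)
  finally show ?case .
qed

lemma r_le_1:
  assumes "a \<in> A"
  shows "r a \<le> 1"
proof -
  have "r a \<le> (\<Sum>b\<in>{b\<in>A. lay (src b) = lay (src a)}. r b)"
    using assms finite_A r_nonneg by (intro member_le_sum) auto
  then show ?thesis using layer_total lay_tl[OF assms] by simp
qed

text \<open>Conditioned on the node reached in layer \<open>k + 1\<close>, the expected sum of the labels of the
  previous arcs of a random path with flow \<open>r\<close> is a point of the convex set of that node.\<close>

lemma flow_prefix:
  fixes g :: "'a \<Rightarrow> 'e::real_vector"
  assumes s0: "L 1 = {s0}"
    and cvx: "\<And>N. N \<in> V \<Longrightarrow> convex (S N)" and ne: "\<And>N. N \<in> V \<Longrightarrow> S N \<noteq> {}"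
    and S_root: "0 \<in> S s0"
    and S_step: "\<And>a p. a \<in> A \<Longrightarrow> p \<in> S (src a) \<Longrightarrow> p + g a \<in> S (dst a)"
    and "1 \<le> k" "k \<le> n"
  shows "\<exists>p. (\<forall>N\<in>L (Suc k). p N \<in> S N) \<and>
    (\<Sum>N\<in>L (Suc k). (\<Sum>a\<in>{a\<in>A. dst a = N}. r a) *\<^sub>R p N)
      = (\<Sum>a\<in>{a\<in>A. lay (src a) \<le> k}. r a *\<^sub>R g a)"
proof -
  \<comment> \<open>One layer further, without enumerating paths. Layer \<open>k\<close> is weighted
    by outflow and layer \<open>k + 1\<close> by inflow: this form covers the first layer, which no
    arc enters, and conservation links consecutive applications.\<close>
  have extend: "\<exists>p'. (\<forall>N\<in>L (Suc k). p' N \<in> S N) \<and>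
      (\<Sum>N\<in>L (Suc k). (\<Sum>a\<in>{a\<in>A. dst a = N}. r a) *\<^sub>R p' N)
        = (\<Sum>N\<in>L k. (\<Sum>a\<in>{a\<in>A. src a = N}. r a) *\<^sub>R p N)
          + (\<Sum>a\<in>{a\<in>A. lay (src a) = k}. r a *\<^sub>R g a)"
    if p: "\<forall>N\<in>L k. p N \<in> S N" for p k
  proof -
    define inflow where "inflow N = (\<Sum>a\<in>{a\<in>A. dst a = N}. r a)" for N
    define q where "q N = (\<Sum>a\<in>{a\<in>A. dst a = N}. r a *\<^sub>R (p (src a) + g a))" for N
    \<comment> \<open>The conditional mean of the extended sums over the arcs entering
      \<open>N\<close>. At a node without inflow the mean is undefined; any point of
      \<open>S N\<close> serves there, since it gets weight 0.\<close>
    define p' where "p' N = (if inflow N = 0 then SOME x. x \<in> S N else q N /\<^sub>R inflow N)" for N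
    have "p' N \<in> S N" if N: "N \<in> L (Suc k)" for N
    proof (cases "inflow N = 0")
      case True
      then show ?thesis using ne[of N] N by (auto simp: p'_def L_def some_in_eq)
    next
      case False
      have "(\<Sum>a\<in>{a\<in>A. dst a = N}. (r a / inflow N) *\<^sub>R (p (src a) + g a)) \<in> S N"
      proof (rule convex_sum)
        show "finite {a\<in>A. dst a = N}" using finite_A by simp
        show "convex (S N)" using cvx N by (simp add: L_def)
        show "(\<Sum>a\<in>{a\<in>A. dst a = N}. r a / inflow N) = 1"
          using False by (simp add: sum_divide_distrib[symmetric] inflow_def)
        have "inflow N \<ge> 0" unfolding inflow_def using r_nonneg by (intro sum_nonneg) auto
        then show "0 \<le> r a / inflow N" if "a \<in> {a\<in>A. dst a = N}" for a
          using r_nonneg that by simp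
        show "p (src a) + g a \<in> S N" if "a \<in> {a\<in>A. dst a = N}" for a
        proof -
          have "src a \<in> L k" using that N lay_hd[of a] tl_V[of a] by (auto simp: L_def)
          then show ?thesis using S_step[of a] p that by auto
        qed
      qed
      then show ?thesis using False
        by (simp add: p'_def q_def scaleR_sum_right divide_inverse mult.commute)
    qed
    moreover have "inflow N *\<^sub>R p' N = q N" if N: "N \<in> L (Suc k)" for N
    proof (cases "inflow N = 0")
      case True
      then have "\<forall>a\<in>{a\<in>A. dst a = N}. r a = 0"
        unfolding inflow_def using finite_A r_nonneg by (subst (asm) sum_nonneg_eq_0_iff) auto
      then show ?thesis using True by (auto simp: q_def)
    qed (simp add: p'_def)
    moreover have "(\<Sum>N\<in>L (Suc k). q N) = (\<Sum>a\<in>{a\<in>A. lay (src a) = k}. r a *\<^sub>R (p (src a) + g a))"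
      unfolding q_def by (rule sum_L_hd)
    moreover have "\<dots> = (\<Sum>a\<in>{a\<in>A. lay (src a) = k}. r a *\<^sub>R p (src a))
        + (\<Sum>a\<in>{a\<in>A. lay (src a) = k}. r a *\<^sub>R g a)"
      by (simp add: scaleR_right_distrib sum.distrib)
    moreover have "(\<Sum>a\<in>{a\<in>A. lay (src a) = k}. r a *\<^sub>R p (src a))
        = (\<Sum>N\<in>L k. (\<Sum>a\<in>{a\<in>A. src a = N}. r a) *\<^sub>R p N)"
      unfolding sum_L_tl[symmetric] by (intro sum.cong) (auto simp: scaleR_sum_left)
    ultimately show ?thesis unfolding inflow_def by (intro exI[of _ p']) auto
  qed
  show ?thesis using \<open>1 \<le> k\<close> \<open>k \<le> n\<close>
  proof (induction k rule: dec_induct)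
    case base
    \<comment> \<open>No arc precedes the root, so the prefix sum there is 0, which lies in
      \<open>S s0\<close>.\<close>
    have "{a\<in>A. lay (src a) \<le> 1} = {a\<in>A. lay (src a) = 1}" using lay_tl by force
    then show ?case using extend[of 1 "\<lambda>_. 0"] s0 S_root by simp
  next
    case (step k)
    then obtain p where p: "\<forall>N\<in>L (Suc k). p N \<in> S N"
      "(\<Sum>N\<in>L (Suc k). (\<Sum>a\<in>{a\<in>A. dst a = N}. r a) *\<^sub>R p N)
        = (\<Sum>a\<in>{a\<in>A. lay (src a) \<le> k}. r a *\<^sub>R g a)" by auto
    have "(\<Sum>N\<in>L (Suc k). (\<Sum>a\<in>{a\<in>A. src a = N}. r a) *\<^sub>R p N)
        = (\<Sum>N\<in>L (Suc k). (\<Sum>a\<in>{a\<in>A. dst a = N}. r a) *\<^sub>R p N)"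
      using step by (intro sum.cong) (auto simp: conservation L_def)
    moreover have "{a\<in>A. lay (src a) \<le> Suc k} = {a\<in>A. lay (src a) \<le> k} \<union> {a\<in>A. lay (src a) = Suc k}"
      by auto
    then have "(\<Sum>a\<in>{a\<in>A. lay (src a) \<le> Suc k}. r a *\<^sub>R g a)
      = (\<Sum>a\<in>{a\<in>A. lay (src a) \<le> k}. r a *\<^sub>R g a) + (\<Sum>a\<in>{a\<in>A. lay (src a) = Suc k}. r a *\<^sub>R g a)"
      using finite_A by (simp only:) (rule sum.union_disjoint, auto)
    ultimately show ?case using extend[OF p(1)] p(2) by simp
  qed
qed

text \<open>In layer \<open>n + 1\<close> the prefixes are whole paths and the inflows are
  nonnegative with total 1, so the sum in \<open>flow_prefix\<close> is a convex combination of
  points of \<open>T\<close>.\<close>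

lemma flow_sum_in_convex:
  fixes g :: "'a \<Rightarrow> 'e::real_vector"
  assumes s0: "L 1 = {s0}"
    and cvx: "\<And>N. N \<in> V \<Longrightarrow> convex (S N)" and ne: "\<And>N. N \<in> V \<Longrightarrow> S N \<noteq> {}"
    and S_root: "0 \<in> S s0"
    and S_step: "\<And>a p. a \<in> A \<Longrightarrow> p \<in> S (src a) \<Longrightarrow> p + g a \<in> S (dst a)"
    and "1 \<le> n" and T: "convex T" "\<And>N. N \<in> V \<Longrightarrow> lay N = Suc n \<Longrightarrow> S N \<subseteq> T"
  shows "(\<Sum>a\<in>A. r a *\<^sub>R g a) \<in> T"
proof -
  obtain p where p: "\<forall>N\<in>L (Suc n). p N \<in> S N"
    "(\<Sum>N\<in>L (Suc n). (\<Sum>a\<in>{a\<in>A. dst a = N}. r a) *\<^sub>R p N)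
      = (\<Sum>a\<in>{a\<in>A. lay (src a) \<le> n}. r a *\<^sub>R g a)"
    using flow_prefix[OF s0 cvx ne S_root S_step \<open>1 \<le> n\<close>] by blast
  have "{a\<in>A. lay (src a) \<le> n} = A" using lay_tl by auto
  moreover have "(\<Sum>N\<in>L (Suc n). (\<Sum>a\<in>{a\<in>A. dst a = N}. r a) *\<^sub>R p N) \<in> T"
  proof (rule convex_sum[OF finite_L \<open>convex T\<close>])
    show "(\<Sum>N\<in>L (Suc n). \<Sum>a\<in>{a\<in>A. dst a = N}. r a) = 1"
      using layer_total \<open>1 \<le> n\<close> by (simp add: sum_L_hd)
    show "0 \<le> (\<Sum>a\<in>{a\<in>A. dst a = N}. r a)" for N
      using r_nonneg by (auto intro!: sum_nonneg)
    show "p N \<in> T" if "N \<in> L (Suc n)" for N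
      using that p(1) T(2)[of N] by (auto simp: L_def)
  qed
  ultimately show ?thesis using p(2) by simp
qed

end

subsection \<open>The perspective of the square\<close>

text \<open>Since \<open>w\<^sup>2 / r = sup\<^sub>s (2 s w - s\<^sup>2 r)\<close>, the only nonlinear constraint of the
  relaxation is an intersection of half-spaces; so convexity and closedness can be checked on
  affine constraints.\<close>

lemma sum_quad_over_lin_le_iff:
  fixes w r :: "'a \<Rightarrow> real"
  assumes fin: "finite A" and r: "\<And>a. a \<in> A \<Longrightarrow> 0 \<le> r a"
  shows "(\<Sum>a\<in>A. quad_over_lin (w a) (r a)) \<le> ereal t \<longleftrightarrow>
    (\<forall>a\<in>A. r a = 0 \<longrightarrow> w a = 0) \<and> (\<Sum>a\<in>A. (w a)\<^sup>2 / r a) \<le> t"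
proof (cases "\<forall>a\<in>A. r a = 0 \<longrightarrow> w a = 0")
  case True
  then have "(\<Sum>a\<in>A. quad_over_lin (w a) (r a)) = (\<Sum>a\<in>A. ereal ((w a)\<^sup>2 / r a))"
    by (intro sum.cong) (auto simp: quad_over_lin_def)
  then show ?thesis using True by simp
next
  case False
  then obtain a where a: "a \<in> A" "r a = 0" "w a \<noteq> 0" by auto
  then have "(\<Sum>a\<in>A. quad_over_lin (w a) (r a)) = \<infinity>"
    unfolding sum_Pinfty using fin by (auto intro!: bexI[of _ a] simp: quad_over_lin_def)
  then show ?thesis using False by simp
qed

lemma sum_quad_over_lin_le_iff_linear:
  fixes w r :: "'a \<Rightarrow> real"
  assumes fin: "finite A" and r: "\<And>a. a \<in> A \<Longrightarrow> 0 \<le> r a"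
  shows "(\<Sum>a\<in>A. quad_over_lin (w a) (r a)) \<le> ereal t \<longleftrightarrow>
    (\<forall>s. (\<Sum>a\<in>A. 2 * s a * w a - (s a)\<^sup>2 * r a) \<le> t)"
proof (subst sum_quad_over_lin_le_iff, simp_all only: assms, intro iffI conjI allI ballI impI)
  fix s :: "'a \<Rightarrow> real"
  assume *: "(\<forall>a\<in>A. r a = 0 \<longrightarrow> w a = 0) \<and> (\<Sum>a\<in>A. (w a)\<^sup>2 / r a) \<le> t"
  have "2 * s a * w a - (s a)\<^sup>2 * r a \<le> (w a)\<^sup>2 / r a" if "a \<in> A" for a
  proof (cases "r a = 0")
    case False
    \<comment> \<open>Completing the square: the gap between the perspective and its affine minorant
      with slope parameter \<open>s a\<close>.\<close>
    have "0 \<le> (w a - s a * r a)\<^sup>2 / r a" using r[OF that] by simp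
    also have "\<dots> = (w a)\<^sup>2 / r a - (2 * s a * w a - (s a)\<^sup>2 * r a)"
      using False by (simp add: field_simps power2_eq_square)
    finally show ?thesis by simp
  qed (use * that in simp)
  then have "(\<Sum>a\<in>A. 2 * s a * w a - (s a)\<^sup>2 * r a) \<le> (\<Sum>a\<in>A. (w a)\<^sup>2 / r a)" by (rule sum_mono)
  then show "(\<Sum>a\<in>A. 2 * s a * w a - (s a)\<^sup>2 * r a) \<le> t" using * by simp
next
  fix a
  assume *: "\<forall>s. (\<Sum>a\<in>A. 2 * s a * w a - (s a)\<^sup>2 * r a) \<le> t" and a: "a \<in> A" "r a = 0"
  show "w a = 0"
  proof (rule ccontr)
    assume w: "w a \<noteq> 0"
    \<comment> \<open>If \<open>r a = 0\<close>, the term of \<open>a\<close> is linear in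
      \<open>s a\<close> without a quadratic penalty; this value makes the whole sum
      \<open>t + 1\<close>.\<close>
    define s where "s = (\<lambda>b. if b = a then (t + 1) / (2 * w a) else 0)"
    have "(\<Sum>a\<in>A. 2 * s a * w a - (s a)\<^sup>2 * r a) = (\<Sum>b\<in>A. if b = a then t + 1 else 0)"
      using a w by (intro sum.cong) (auto simp: s_def)
    also have "\<dots> = t + 1" using fin a by simp
    finally show False using *[rule_format, of s] by simp
  qed
next
  assume *: "\<forall>s. (\<Sum>a\<in>A. 2 * s a * w a - (s a)\<^sup>2 * r a) \<le> t"
  \<comment> \<open>The supremum is attained at \<open>s = w / r\<close>. Where
    \<open>r a = 0\<close>, division by zero makes both terms 0.\<close>
  have "(\<Sum>a\<in>A. (w a)\<^sup>2 / r a) = (\<Sum>a\<in>A. 2 * (w a / r a) * w a - (w a / r a)\<^sup>2 * r a)"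
    by (intro sum.cong) (auto simp: power2_eq_square)
  then show "(\<Sum>a\<in>A. (w a)\<^sup>2 / r a) \<le> t" using *[rule_format, of "\<lambda>a. w a / r a"] by simp
qed

text \<open>Bolzano-Weierstrass for functions that are controlled on a finite index set only, as the
  arc variables are; the subsequence is common to all indices.\<close>

lemma bounded_coordinates_imp_convergent_subsequence:
  fixes f :: "nat \<Rightarrow> 'a \<Rightarrow> 'b::heine_borel"
  assumes "finite A" "\<And>a. a \<in> A \<Longrightarrow> bounded (range (\<lambda>k. f k a))"
  shows "\<exists>l \<phi>. strict_mono (\<phi> :: nat \<Rightarrow> nat) \<and> (\<forall>a\<in>A. (\<lambda>k. f (\<phi> k) a) \<longlonglongrightarrow> l a)"
proof -
  have "\<forall>d\<subseteq>A. \<exists>l \<phi>. strict_mono (\<phi> :: nat \<Rightarrow> nat) \<and>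
      (\<forall>e>0. eventually (\<lambda>n. \<forall>i\<in>d. dist (f (\<phi> n) i) (l i) < e) sequentially)"
    by (rule compact_lemma_general[where unproj = "\<lambda>e. e"])
      (use assms in \<open>auto simp: image_image\<close>)
  then obtain l \<phi> where l: "strict_mono (\<phi> :: nat \<Rightarrow> nat)"
    "\<forall>e>0. eventually (\<lambda>n. \<forall>i\<in>A. dist (f (\<phi> n) i) (l i) < e) sequentially" by blast
  have "(\<lambda>k. f (\<phi> k) a) \<longlonglongrightarrow> l a" if "a \<in> A" for a
    unfolding tendsto_iff using l(2) that by (auto elim!: eventually_mono)
  then show ?thesis using l(1) by blast
qed

subsection \<open>Coordinates and linear algebra\<close>

lemma length_coords [simp]: "length (coords x) = CARD('n)"
  for x :: "'a^'n::{finite,linorder}"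
  by (simp add: coords_def)

lemma coords_nth: "k < CARD('n) \<Longrightarrow> coords x ! k = x $ index (Suc k)"
  for x :: "'a^'n::{finite,linorder}"
  by (simp add: coords_def index_def)

lemma bij_betw_index: "bij_betw (\<lambda>k. index (Suc k) :: 'n::{finite,linorder}) {..<CARD('n)} UNIV"
proof -
  have "bij_betw ((!) (sorted_list_of_set (UNIV :: 'n set))) {..<CARD('n)} UNIV"
    by (rule bij_betw_nth) auto
  then show ?thesis by (simp add: index_def)
qed

lemma index_eq_iff:
  "j < CARD('n) \<Longrightarrow> k < CARD('n) \<Longrightarrow> index (Suc j) = (index (Suc k) :: 'n::{finite,linorder}) \<longleftrightarrow> j = k"
  using bij_betw_index[where 'n = 'n] by (auto simp: bij_betw_def inj_on_def)

lemma index_cases: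
  obtains k where "k < CARD('n)" "i = (index (Suc k) :: 'n::{finite,linorder})"
  using bij_betw_index[where 'n = 'n] unfolding bij_betw_def by (metis UNIV_I image_iff lessThan_iff)

lemma sum_UNIV_index: "(\<Sum>i\<in>UNIV. f i) = (\<Sum>k<CARD('n). f (index (Suc k) :: 'n::{finite,linorder}))"
  by (rule sum.reindex_bij_betw[OF bij_betw_index, symmetric])

text \<open>Serves to replace a row of \<open>F\<close> by its Gram-Schmidt residual without
  changing the span.\<close>

lemma span_insert_cong:
  fixes S :: "'a::real_vector set"
  assumes "subspace S" "x - y \<in> S"
  shows "span (insert x S) = span (insert y S)"
proof -
  have "span (insert x S) \<subseteq> span (insert y S)" if "x - y \<in> S" for x y
  proof -
    have "x \<in> span (insert y S)"
      using span_add[OF span_base[of y "insert y S"] span_base[of "x - y" "insert y S"]] that by simp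
    then show ?thesis by (intro span_minimal) (auto simp: span_base)
  qed
  moreover have "y - x \<in> S" using subspace_neg[OF assms] by simp
  ultimately show ?thesis using assms(2) by blast
qed

lemma subspace_coordinatewise_annihilator: "subspace {x :: real^'n. \<forall>i. x $ i * c i = 0}"
proof -
  have "linear (\<lambda>x :: real^'n. \<chi> i. x $ i * c i)"
    by (rule linearI) (simp_all add: vec_eq_iff algebra_simps)
  from linear_subspace_kernel[OF this] show ?thesis by (simp add: vec_eq_iff)
qed

lemma transpose_mult_conv_sum: "transpose F *v x = (\<Sum>i\<in>UNIV. x $ i *\<^sub>R F $ i)"
  for F :: "real^'m^'n"
  by (simp add: vec_eq_iff matrix_vector_mult_def transpose_def mult.commute)

text \<open>Identifies an update of a row in the diagram as one Gram-Schmidt step: the component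
  along \<open>u\<close> is subtracted.\<close>

lemma vector_mult_projector: "h v* projector u = h - ((h \<bullet> u) / (norm u)\<^sup>2) *\<^sub>R u"
proof -
  have "(\<Sum>i\<in>UNIV. h $ i * (u $ i * u $ j / (norm u)\<^sup>2)) = (h \<bullet> u) / (norm u)\<^sup>2 * u $ j" for j
    by (simp add: inner_vec_def sum_divide_distrib sum_distrib_right mult.assoc)
  then show ?thesis
    by (simp add: projector_def vec_eq_iff vector_matrix_mult_def mat_def algebra_simps
        sum_subtractf sum.distrib if_distrib[of "\<lambda>x. _ * x"] cong: if_cong)
qed

lemma inner_vector_mult_projector: "u \<noteq> 0 \<Longrightarrow> (h v* projector u) \<bullet> u = 0"
  by (simp add: vector_mult_projector inner_diff_left power2_norm_eq_inner)

subsection \<open>Nodes and arcs of the diagram\<close>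

text \<open>A partial solution is padded with zeros, so that appending a decision adds the
  contribution of one arc to \<open>z\<close>.\<close>

definition indicator_vec :: "bool list \<Rightarrow> real^'n::{finite,linorder}" where
  "indicator_vec v = (\<Sum>k<length v. of_bool (v ! k) *\<^sub>R axis (index (Suc k)) 1)"

lemma indicator_vec_snoc:
  "indicator_vec (v @ [b]) = indicator_vec v + of_bool b *\<^sub>R axis (index (Suc (length v))) 1"
  by (simp add: indicator_vec_def nth_append)

lemma indicator_vec_nth:
  assumes "length v = CARD('n)" "k < CARD('n)"
  shows "(indicator_vec v :: real^'n::{finite,linorder}) $ index (Suc k) = of_bool (v ! k)"
proof -
  have "(indicator_vec v :: (real, 'n) vec) $ index (Suc k) = (\<Sum>j<CARD('n). if j = k then of_bool (v ! k) else 0)"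
    unfolding indicator_vec_def assms(1) sum_component using assms(2)
    by (intro sum.cong) (auto simp: axis_def index_eq_iff)
  then show ?thesis using assms by simp
qed

locale exact_diagram =
  fixes F :: "real^'m^'n::{finite,linorder}"
    and Z :: "(real^'n::{finite,linorder}) set"
    and \<rho> :: "nat \<Rightarrow> bool list \<Rightarrow> 's"
    and \<psi> :: "'s \<Rightarrow> bool \<Rightarrow> 's"
  assumes Z_01: "Z \<subseteq> {z. \<forall>i. z $ i \<in> {0, 1}}"
    and dp: "dp_representation Z \<rho> \<psi>"
begin

abbreviation "nodes \<equiv> dd_nodes F Z \<rho> \<psi>"
abbreviation "arcs \<equiv> dd_arcs F Z \<rho> \<psi>"

text \<open>Total in \<open>v\<close>: heads are followed along infeasible decisions too, and
  feasibility is tracked separately.\<close>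

definition node :: "bool list \<Rightarrow> ('s, real^'m) dd_node" where
  "node v = foldl (\<lambda>N b. head \<psi> (Arc N b)) (Node 1 (\<rho> 1 []) (coords F)) v"

definition feasible :: "bool list \<Rightarrow> bool" where
  "feasible v \<longleftrightarrow> completions Z (length v + 1) v \<noteq> {}"

definition row_span :: "bool list \<Rightarrow> (real^'m) set" where
  "row_span v = span ((\<lambda>k. F $ index (Suc k)) ` {k. k < length v \<and> v ! k})"

lemma node_Nil: "node [] = Node 1 (\<rho> 1 []) (coords F)"
  by (simp add: node_def)

lemma node_snoc: "node (v @ [b]) = head \<psi> (Arc (node v) b)"
  by (simp add: node_def)

lemma layer_head [simp]: "layer (head \<psi> a) = Suc (layer (tail a))"
  by (simp add: head_def Let_def)

lemma layer_node [simp]: "layer (node v) = Suc (length v)"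
  by (induction v rule: rev_induct) (simp_all add: node_Nil node_snoc)

section \<open>Feasible partial solutions and the nodes they reach\<close>

lemma feasible_iff: "feasible v \<longleftrightarrow> (\<exists>z\<in>Z. \<exists>w. coords z = map of_bool (v @ w))"
proof
  assume "\<exists>z\<in>Z. \<exists>w. coords z = map of_bool (v @ w)"
  then obtain z w where *: "z \<in> Z" "coords z = map of_bool (v @ w)" by blast
  from arg_cong[OF *(2), of length] have "length w = CARD('n) - length v" by simp
  then show "feasible v" using * unfolding feasible_def completions_def by auto
qed (auto simp: feasible_def completions_def)

lemma feasible_length: "feasible v \<Longrightarrow> length v \<le> CARD('n)"
proof -
  assume "feasible v"
  then obtain z w where "coords (z :: (real, 'n) vec) = map of_bool (v @ w)" unfolding feasible_iff by blast
  from arg_cong[OF this, of length] show ?thesis by simp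
qed

lemma feasible_appendD: "feasible (v @ w) \<Longrightarrow> feasible v"
  unfolding feasible_iff by (metis append.assoc)

lemma feasible_take: "feasible v \<Longrightarrow> feasible (take k v)"
  by (metis append_take_drop_id feasible_appendD)

lemma bits_of_Z:
  assumes "z \<in> Z"
  obtains v where "coords z = map of_bool v" "length v = CARD('n)"
proof
  show "coords z = map of_bool (map (\<lambda>i. z $ i = 1) (sorted_list_of_set UNIV))"
    using Z_01 assms by (auto simp: coords_def)
qed simp

lemma indicator_vec_unique:
  assumes "coords (z :: (real, 'n) vec) = map of_bool v"
  shows "indicator_vec v = z"
proof -
  have len: "length v = CARD('n)" using arg_cong[OF assms, of length] by simp
  have "indicator_vec v $ i = z $ i" for i
  proof -
    obtain k where k: "k < CARD('n)" "i = index (Suc k)" by (rule index_cases)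
    then have "z $ i = of_bool (v ! k)" using coords_nth[OF k(1), of z] assms len by simp
    then show ?thesis using k len by (simp add: indicator_vec_nth)
  qed
  then show ?thesis by (simp add: vec_eq_iff)
qed

lemma feasible_full_iff:
  assumes "length v = CARD('n)"
  shows "feasible v \<longleftrightarrow> indicator_vec v \<in> Z"
proof
  assume "feasible v"
  then obtain z w where zw: "z \<in> Z" "coords z = map of_bool (v @ w)" unfolding feasible_iff by blast
  from arg_cong[OF zw(2), of length] have "w = []" using assms by simp
  then show "indicator_vec v \<in> Z" using indicator_vec_unique zw by auto
next
  assume Z: "indicator_vec v \<in> Z"
  have "coords (indicator_vec v :: (real, 'n) vec) = map of_bool v"
    using assms by (intro nth_equalityI) (simp_all add: coords_nth indicator_vec_nth)
  then show "feasible v" unfolding feasible_iff using Z by (metis append_Nil2)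
qed

lemma feasible_Nil: "feasible [] \<longleftrightarrow> Z \<noteq> {}"
  unfolding feasible_iff by (metis append_Nil bits_of_Z ex_in_conv)

lemma state_node: "feasible v \<Longrightarrow> state (node v) = \<rho> (Suc (length v)) v"
proof (induction v rule: rev_induct)
  case (snoc b v)
  have v: "feasible v" using snoc.prems feasible_appendD by blast
  have "Suc (length v) \<in> {1..CARD('n)}" using feasible_length[OF snoc.prems] by simp
  moreover have "completions Z (Suc (length v) + 1) (v @ [b]) \<noteq> {}"
    using snoc.prems by (simp add: feasible_def)
  ultimately have "\<rho> (Suc (length v) + 1) (v @ [b]) = \<psi> (\<rho> (Suc (length v)) v) b"
    using dp unfolding dp_representation_def by auto
  then show ?case using snoc.IH[OF v] by (simp add: node_snoc head_def Let_def)
qed (simp add: node_Nil)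

text \<open>A decision is feasible at a state if some partial solution with that state admits it.
  Equal states have equal completion sets, so a completion starting with \<open>b\<close> transfers
  to the given \<open>v\<close>.\<close>

lemma feasible_decision_node:
  assumes v: "feasible v"
  shows "feasible_decision Z \<rho> (layer (node v)) (state (node v)) b \<longleftrightarrow> feasible (v @ [b])"
proof
  assume "feasible_decision Z \<rho> (layer (node v)) (state (node v)) b"
  then obtain v' where v': "length v' = length v" "feasible v'" "\<rho> (Suc (length v)) v' = \<rho> (Suc (length v)) v"
      "feasible (v' @ [b])"
    unfolding feasible_decision_def feasible_def using state_node[OF v] by auto
  have "completions Z (Suc (length v)) v = completions Z (Suc (length v)) v'"
  proof -
    have "Suc (length v) \<in> {1..CARD('n) + 1}" using feasible_length[OF v] by simp
    then show ?thesis using dp v v' unfolding dp_representation_def feasible_def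
      by (metis (no_types, lifting) Suc_eq_plus1 diff_Suc_1)
  qed
  moreover obtain z w where zw: "z \<in> Z" "coords z = map of_bool ((v' @ [b]) @ w)"
    using v'(4) unfolding feasible_iff by blast
  moreover have "length (b # w) = CARD('n) + 1 - Suc (length v')"
    using arg_cong[OF zw(2), of length] by simp
  ultimately have "b # w \<in> completions Z (Suc (length v)) v"
    using v'(1) unfolding completions_def by auto
  then obtain z where "z \<in> Z" "coords z = map of_bool ((v @ [b]) @ w)"
    unfolding completions_def by auto
  then show "feasible (v @ [b])" unfolding feasible_iff by blast
next
  assume "feasible (v @ [b])"
  then show "feasible_decision Z \<rho> (layer (node v)) (state (node v)) b"
    unfolding feasible_decision_def using v state_node[OF v]
    by (auto simp: feasible_def intro!: exI[of _ v])
qed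

lemma node_in_nodes: "feasible v \<Longrightarrow> node v \<in> nodes"
proof (induction v rule: rev_induct)
  case (snoc b v)
  have v: "feasible v" using snoc.prems feasible_appendD by blast
  show ?case unfolding node_snoc
    using snoc.IH[OF v] snoc.prems feasible_length[OF snoc.prems] feasible_decision_node[OF v]
    by (intro dd_nodes.step) auto
qed (use dd_nodes.root[of \<rho> F Z \<psi>] in \<open>simp add: node_Nil\<close>)

text \<open>The root exists even for empty \<open>Z\<close>, when no partial solution is feasible;
  this is why \<open>Z\<close> is assumed nonempty.\<close>

lemma nodes_cases:
  assumes "N \<in> nodes" "Z \<noteq> {}"
  obtains v where "feasible v" "N = node v"
proof -
  have "\<exists>v. feasible v \<and> N = node v" using assms(1)
  proof induction
    case root
    show ?case using assms(2) feasible_Nil node_Nil by (intro exI[of _ "[]"]) simp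
  next
    case (step N b)
    then obtain v where "feasible v" "N = node v" by blast
    then have "feasible (v @ [b])" using step.hyps feasible_decision_node by simp
    then show ?case using node_snoc \<open>N = node v\<close> by (intro exI[of _ "v @ [b]"]) simp
  qed
  then show thesis using that by blast
qed

lemma layer_nodes: "N \<in> nodes \<Longrightarrow> 1 \<le> layer N"
  by (induction rule: dd_nodes.induct) simp_all

lemma layer_1_nodes: "N \<in> nodes \<Longrightarrow> layer N = 1 \<Longrightarrow> N = node []"
proof (erule dd_nodes.cases)
  fix N' b
  assume "layer N = 1" "N = head \<psi> (Arc N' b)" "N' \<in> nodes"
  then show "N = node []" using layer_nodes[of N'] by simp
qed (simp add: node_Nil)

lemma arcs_eq: "arcs = {Arc (node v) b |v b. feasible (v @ [b])}"
proof (cases "Z = {}")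
  case True
  then have "\<not> feasible v" for v unfolding feasible_iff by blast
  then show ?thesis using True
    by (auto simp: dd_arcs_def feasible_decision_def completions_def)
next
  case False
  show ?thesis
  proof (intro equalityI subsetI)
    fix a assume "a \<in> arcs"
    then obtain N b where a: "a = Arc N b" "N \<in> nodes" "feasible_decision Z \<rho> (layer N) (state N) b"
      by (auto simp: dd_arcs_def)
    then show "a \<in> {Arc (node v) b |v b. feasible (v @ [b])}"
    proof -
      obtain v where "feasible v" "N = node v" using nodes_cases[OF a(2) False] .
      then show ?thesis using a feasible_decision_node by blast
    qed
  next
    fix a assume "a \<in> {Arc (node v) b |v b. feasible (v @ [b])}"
    then obtain v b where a: "a = Arc (node v) b" "feasible (v @ [b])" by blast
    then have "feasible v" "length v < CARD('n)"
      using feasible_appendD feasible_length[OF a(2)] by auto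
    then show "a \<in> arcs" using a feasible_decision_node[of v b] node_in_nodes[of v]
      unfolding dd_arcs_def by auto
  qed
qed

lemma arc_feasible:
  "Arc (node v) b \<in> arcs \<Longrightarrow> feasible v \<Longrightarrow> feasible (v @ [b])"
  using feasible_decision_node by (auto simp: dd_arcs_def)

subsection \<open>The recursive Gram--Schmidt process\<close>

lemma subspace_row_span: "subspace (row_span v)"
  by (simp add: row_span_def)

lemma row_span_snoc_False: "row_span (v @ [False]) = row_span v"
proof -
  have "{k. k < length (v @ [False]) \<and> (v @ [False]) ! k} = {k. k < length v \<and> v ! k}"
    by (auto simp: nth_append less_Suc_eq)
  then show ?thesis by (simp only: row_span_def)
qed

lemma row_span_snoc_True:
  "row_span (v @ [True]) = span (insert (F $ index (Suc (length v))) (row_span v))"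
proof -
  have "{k. k < length (v @ [True]) \<and> (v @ [True]) ! k} = insert (length v) {k. k < length v \<and> v ! k}"
    by (auto simp: nth_append less_Suc_eq)
  then have "row_span (v @ [True])
    = span (insert (F $ index (Suc (length v))) ((\<lambda>k. F $ index (Suc k)) ` {k. k < length v \<and> v ! k}))"
    by (simp only: row_span_def image_insert)
  then show ?thesis by (simp add: span_insert span_span row_span_def)
qed

text \<open>The Gram-Schmidt invariant. Being orthogonal to \<open>row_span v\<close> and congruent
  to a row of \<open>F\<close> modulo \<open>row_span v\<close> characterizes a remaining row as the
  orthogonal projection of that row of \<open>F\<close> onto the complement of the span.\<close>

lemma rows_node:
  assumes "length v \<le> CARD('n)"
  shows "length (rows (node v)) = CARD('n) - length v \<and>
    (\<forall>j<CARD('n) - length v. (\<forall>y\<in>row_span v. rows (node v) ! j \<bullet> y = 0) \<and>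
      rows (node v) ! j - F $ index (Suc (length v + j)) \<in> row_span v)"
  using assms
proof (induction v rule: rev_induct)
  case Nil
  then show ?case by (simp add: node_Nil coords_nth row_span_def)
next
  case (snoc b v)
  define H where "H = rows (node v)"
  define u where "u = hd H"
  have len: "length H = CARD('n) - length v" and lt: "length v < CARD('n)"
    and orth: "\<And>j y. j < length H \<Longrightarrow> y \<in> row_span v \<Longrightarrow> H ! j \<bullet> y = 0"
    and diff: "\<And>j. j < length H \<Longrightarrow> H ! j - F $ index (Suc (length v + j)) \<in> row_span v"
    using snoc by (auto simp: H_def)
  have "H \<noteq> []" using len lt by auto
  then have u: "u = H ! 0" by (simp add: u_def hd_conv_nth)
  have len_tl: "length (tl H) = CARD('n) - length (v @ [b])" using len by simp
  have tl: "tl H ! j = H ! Suc j" if "j < length (tl H)" for j using that by (simp add: nth_tl)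
  have rows: "rows (node (v @ [b])) = (if b \<and> u \<noteq> 0 then map (\<lambda>h. h v* projector u) (tl H) else tl H)"
    by (simp add: node_snoc head_def Let_def H_def u_def)
  have orth_u: "u \<bullet> y = 0" if "y \<in> row_span v" for y using orth[of 0] that u len lt by simp
  \<comment> \<open>The first remaining row \<open>u\<close> differs from the newly selected row of
    \<open>F\<close> by an element of the old span.\<close>
  have span_u: "row_span (v @ [True]) = span (insert u (row_span v))"
    unfolding row_span_snoc_True using diff[of 0] len lt
    by (intro span_insert_cong[symmetric]) (auto simp: u subspace_row_span)
  have "(\<forall>y\<in>row_span (v @ [b]). rows (node (v @ [b])) ! j \<bullet> y = 0) \<and>
      rows (node (v @ [b])) ! j - F $ index (Suc (length (v @ [b]) + j)) \<in> row_span (v @ [b])"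
    if j: "j < CARD('n) - length (v @ [b])" for j
  proof -
    have j': "Suc j < length H" using j len by simp
    consider "\<not> b" | "b" "u = 0" | "b" "u \<noteq> 0" by blast
    then show ?thesis
    proof cases
      case 1
      then have "rows (node (v @ [b])) ! j = H ! Suc j" "row_span (v @ [b]) = row_span v"
        using rows tl[of j] len_tl j by (simp_all add: row_span_snoc_False)
      then show ?thesis using orth[OF j'] diff[OF j'] by simp
    next
      case 2
      \<comment> \<open>A zero residual means that the selected row already depends on the earlier
        ones.\<close>
      then have "row_span (v @ [b]) = row_span v"
        using span_u subspace_row_span by (simp add: span_insert_0 span_subspace)
      moreover have "rows (node (v @ [b])) ! j = H ! Suc j" using 2 rows tl[of j] len_tl j by simp
      ultimately show ?thesis using orth[OF j'] diff[OF j'] by simp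
    next
      case 3
      define h where "h = H ! Suc j"
      have nth: "rows (node (v @ [b])) ! j = h v* projector u"
      proof -
        have "rows (node (v @ [b])) = map (\<lambda>h. h v* projector u) (tl H)" using 3 rows by simp
        then show ?thesis using j len_tl tl[of j] unfolding h_def by simp
      qed
      have "(h v* projector u) \<bullet> y = 0" if "y \<in> span (insert u (row_span v))" for y
      proof -
        \<comment> \<open>Both \<open>h\<close> and \<open>u\<close> are orthogonal to the old span,
          hence so is the projected row; orthogonality to \<open>u\<close> holds by construction,
          and the orthogonal complement of a vector is a subspace.\<close>
        have "(h v* projector u) \<bullet> y = 0" if "y \<in> row_span v" for y
          using that orth[OF j'] orth_u by (simp add: vector_mult_projector inner_diff_left h_def)
        then have "insert u (row_span v) \<subseteq> {y. (h v* projector u) \<bullet> y = 0}"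
          using inner_vector_mult_projector[OF 3(2)] by auto
        moreover have "subspace {y. (h v* projector u) \<bullet> y = 0}" by (rule subspace_hyperplane)
        ultimately show ?thesis using that span_minimal by blast
      qed
      moreover have "h - F $ index (Suc (Suc (length v + j))) \<in> span (insert u (row_span v))"
        using diff[OF j'] by (auto simp: h_def intro: span_base)
      then have "h - F $ index (Suc (Suc (length v + j))) - ((h \<bullet> u) / (norm u)\<^sup>2) *\<^sub>R u
          \<in> span (insert u (row_span v))"
        by (rule span_diff) (intro span_scale span_base insertI1)
      then have "h v* projector u - F $ index (Suc (Suc (length v + j))) \<in> span (insert u (row_span v))"
        by (simp add: vector_mult_projector algebra_simps)
      ultimately show ?thesis using 3 span_u nth by simp
    qed
  qed
  moreover have "length (rows (node (v @ [b]))) = CARD('n) - length (v @ [b])"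
    using len_tl by (simp add: rows)
  ultimately show ?case by blast
qed

text \<open>What the later argument uses of Gram-Schmidt, read off \<open>rows_node\<close> at the
  first remaining row: along a path the transition vectors are pairwise orthogonal, of norm 0 or 1,
  and span the selected rows.\<close>

lemma
  assumes "length v < CARD('n)"
  shows transition_orthogonal: "y \<in> row_span v \<Longrightarrow> transition (Arc (node v) b) \<bullet> y = 0"
    and row_span_step: "row_span (v @ [b]) = span (insert (transition (Arc (node v) b)) (row_span v))"
    and norm_transition: "transition (Arc (node v) b) = 0 \<or> norm (transition (Arc (node v) b)) = 1"
proof -
  define u where "u = hd (rows (node v))"
  have len: "0 < length (rows (node v))" using rows_node[of v] assms by simp
  then have u: "u = rows (node v) ! 0" by (simp add: u_def hd_conv_nth)
  have orth: "u \<bullet> y = 0" if "y \<in> row_span v" for y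
    using rows_node[of v] assms that by (auto simp: u)
  have "u - F $ index (Suc (length v)) \<in> row_span v"
    using rows_node[of v] assms by (force simp: u)
  then have span_u: "row_span (v @ [True]) = span (insert u (row_span v))"
    unfolding row_span_snoc_True
    by (intro span_insert_cong[symmetric]) (auto simp: u subspace_row_span)
  have t: "transition (Arc (node v) b) = (if b \<and> u \<noteq> 0 then u /\<^sub>R norm u else 0)"
    by (simp add: transition_def Let_def u_def)
  show "transition (Arc (node v) b) \<bullet> y = 0" if "y \<in> row_span v"
    using orth that by (simp add: t)
  show "transition (Arc (node v) b) = 0 \<or> norm (transition (Arc (node v) b)) = 1"
    by (simp add: t)
  have sp: "span (row_span v) = row_span v" by (simp add: row_span_def)
  consider "\<not> b" | "b" "u = 0" | "b" "u \<noteq> 0" by blast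
  then show "row_span (v @ [b]) = span (insert (transition (Arc (node v) b)) (row_span v))"
  proof cases
    case 3
    have "span (insert u (row_span v)) = span (insert (u /\<^sub>R norm u) (row_span v))"
    proof (intro equalityI span_minimal subspace_span insert_subsetI)
      have "norm u *\<^sub>R (u /\<^sub>R norm u) \<in> span (insert (u /\<^sub>R norm u) (row_span v))"
        by (intro span_scale span_base) simp
      then show "u \<in> span (insert (u /\<^sub>R norm u) (row_span v))" using 3 by simp
      show "u /\<^sub>R norm u \<in> span (insert u (row_span v))"
        by (intro span_scale span_base) simp
    qed (auto intro: span_base)
    then show ?thesis using 3 span_u t by simp
  qed (use span_u t in \<open>simp_all add: span_insert_0 row_span_snoc_False sp\<close>)
qed

subsection \<open>The relaxation\<close>

text \<open>The constraints of \<open>R_set\<close> with the perspective constraint replaced by its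
  affine minorants and without extensionality. Each constraint is then visibly preserved by convex
  combinations and by limits.\<close>

definition relax ::
  "real \<Rightarrow> (real, 'n) vec \<Rightarrow> (real, 'n) vec \<Rightarrow> (('s, real^'m) dd_arc \<Rightarrow> real) \<Rightarrow> (('s, real^'m) dd_arc \<Rightarrow> real) \<Rightarrow> bool"
  where "relax t x z w r \<longleftrightarrow>
    (\<forall>s. (\<Sum>a\<in>arcs. 2 * s a * w a - (s a)\<^sup>2 * r a) \<le> t) \<and>
    transpose F *v x = (\<Sum>a\<in>arcs. w a *\<^sub>R transition a) \<and>
    z = (\<Sum>a\<in>{a\<in>arcs. val a}. r a *\<^sub>R axis (index (layer (tail a))) 1) \<and>
    (\<forall>N\<in>nodes. 2 \<le> layer N \<and> layer N \<le> CARD('n) \<longrightarrow>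
      (\<Sum>a\<in>{a\<in>arcs. head \<psi> a = N}. r a) = (\<Sum>a\<in>{a\<in>arcs. tail a = N}. r a)) \<and>
    (\<Sum>a\<in>{a\<in>arcs. layer (tail a) = 1}. r a) = 1 \<and>
    (\<Sum>a\<in>{a\<in>arcs. layer (tail a) = CARD('n)}. r a) = 1 \<and>
    (\<forall>a\<in>arcs. 0 \<le> r a)"

lemma relaxD:
  assumes "relax t x z w r"
  shows relax_quad: "(\<Sum>a\<in>arcs. 2 * s a * w a - (s a)\<^sup>2 * r a) \<le> t"
    and relax_x: "transpose F *v x = (\<Sum>a\<in>arcs. w a *\<^sub>R transition a)"
    and relax_z: "z = (\<Sum>a\<in>{a\<in>arcs. val a}. r a *\<^sub>R axis (index (layer (tail a))) 1)"
    and relax_conservation: "N \<in> nodes \<Longrightarrow> 2 \<le> layer N \<Longrightarrow> layer N \<le> CARD('n) \<Longrightarrow>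
      (\<Sum>a\<in>{a\<in>arcs. head \<psi> a = N}. r a) = (\<Sum>a\<in>{a\<in>arcs. tail a = N}. r a)"
    and relax_source: "(\<Sum>a\<in>{a\<in>arcs. layer (tail a) = 1}. r a) = 1"
    and relax_sink: "(\<Sum>a\<in>{a\<in>arcs. layer (tail a) = CARD('n)}. r a) = 1"
    and relax_nonneg: "a \<in> arcs \<Longrightarrow> 0 \<le> r a"
  using assms unfolding relax_def by blast+

lemma relax_cong:
  assumes "\<And>a. a \<in> arcs \<Longrightarrow> w a = w' a" "\<And>a. a \<in> arcs \<Longrightarrow> r a = r' a"
  shows "relax t x z w r \<longleftrightarrow> relax t x z w' r'"
proof -
  have "(\<Sum>a\<in>{a\<in>arcs. P a}. r a) = (\<Sum>a\<in>{a\<in>arcs. P a}. r' a)" for P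
    using assms by (intro sum.cong) auto
  moreover have "(\<Sum>a\<in>{a\<in>arcs. val a}. r a *\<^sub>R axis (index (layer (tail a))) (1::real) :: (real, 'n) vec)
      = (\<Sum>a\<in>{a\<in>arcs. val a}. r' a *\<^sub>R axis (index (layer (tail a))) 1)"
    using assms by (intro sum.cong) auto
  ultimately show ?thesis unfolding relax_def using assms by (simp cong: sum.cong)
qed

lemma R_set_iff:
  "(t, x, z, w, r) \<in> R_set F Z \<rho> \<psi> \<longleftrightarrow> w \<in> extensional arcs \<and> r \<in> extensional arcs \<and> relax t x z w r"
proof -
  have "(\<Sum>a\<in>arcs. quad_over_lin (w a) (r a)) \<le> ereal t \<longleftrightarrow>
      (\<forall>s. (\<Sum>a\<in>arcs. 2 * s a * w a - (s a)\<^sup>2 * r a) \<le> t)" if "\<forall>a\<in>arcs. 0 \<le> r a"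
    using that by (intro sum_quad_over_lin_le_iff_linear finite_dd_arcs) auto
  then show ?thesis unfolding R_set_def relax_def Let_def by auto
qed

lemma proj_R_set: "(\<lambda>(t, x, z, w, r). (t, x, z)) ` R_set F Z \<rho> \<psi> = {(t, x, z). \<exists>w r. relax t x z w r}"
proof (intro equalityI subsetI)
  fix p assume "p \<in> {(t, x, z). \<exists>w r. relax t x z w r}"
  then obtain t x z w r where p: "p = (t, x, z)" "relax t x z w r" by auto
  \<comment> \<open>Values outside the arcs do not enter any constraint, so extensionality can be
    restored.\<close>
  have "relax t x z (restrict w arcs) (restrict r arcs)"
    using p(2) by (subst relax_cong[of _ w _ r]) auto
  then have "(t, x, z, restrict w arcs, restrict r arcs) \<in> R_set F Z \<rho> \<psi>"
    by (simp add: R_set_iff)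
  then show "p \<in> (\<lambda>(t, x, z, w, r). (t, x, z)) ` R_set F Z \<rho> \<psi>"
    using p(1) by (force intro: rev_image_eqI)
qed (auto simp: R_set_iff; blast)

section \<open>Convexity and closedness of the projected relaxation\<close>

lemma convex_proj_R_set: "convex {(t, x, z). \<exists>w r. relax t x z w r}"
proof (rule convexI)
  fix p p' and u v :: real
  assume "p \<in> {(t, x, z). \<exists>w r. relax t x z w r}" "p' \<in> {(t, x, z). \<exists>w r. relax t x z w r}"
    and uv: "0 \<le> u" "0 \<le> v" "u + v = 1"
  then obtain t x z w r t' x' z' w' r' where p: "p = (t, x, z)" "p' = (t', x', z')"
    and R: "relax t x z w r" "relax t' x' z' w' r'" by blast
  define w'' r'' where "w'' = (\<lambda>a. u * w a + v * w' a)" and "r'' = (\<lambda>a. u * r a + v * r' a)"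
  have sum_r: "(\<Sum>a\<in>B. r'' a) = u * (\<Sum>a\<in>B. r a) + v * (\<Sum>a\<in>B. r' a)" for B
    by (simp add: r''_def sum.distrib sum_distrib_left)
  have sum_w_scaleR: "(\<Sum>a\<in>B. w'' a *\<^sub>R f a) = u *\<^sub>R (\<Sum>a\<in>B. w a *\<^sub>R f a) + v *\<^sub>R (\<Sum>a\<in>B. w' a *\<^sub>R f a)"
    for B and f :: "_ \<Rightarrow> real^'m"
    by (simp add: w''_def sum.distrib scaleR_sum_right scaleR_left_distrib)
  have sum_r_scaleR: "(\<Sum>a\<in>B. r'' a *\<^sub>R f a) = u *\<^sub>R (\<Sum>a\<in>B. r a *\<^sub>R f a) + v *\<^sub>R (\<Sum>a\<in>B. r' a *\<^sub>R f a)"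
    for B and f :: "_ \<Rightarrow> (real, 'n) vec"
    by (simp add: r''_def sum.distrib scaleR_sum_right scaleR_left_distrib)
  have quad: "(\<Sum>a\<in>arcs. 2 * s a * w'' a - (s a)\<^sup>2 * r'' a) \<le> u * t + v * t'" for s
  proof -
    have "(\<Sum>a\<in>arcs. 2 * s a * w'' a - (s a)\<^sup>2 * r'' a)
        = (\<Sum>a\<in>arcs. u * (2 * s a * w a - (s a)\<^sup>2 * r a) + v * (2 * s a * w' a - (s a)\<^sup>2 * r' a))"
      by (intro sum.cong) (auto simp: w''_def r''_def algebra_simps)
    also have "\<dots> = u * (\<Sum>a\<in>arcs. 2 * s a * w a - (s a)\<^sup>2 * r a)
        + v * (\<Sum>a\<in>arcs. 2 * s a * w' a - (s a)\<^sup>2 * r' a)"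
      by (simp only: sum.distrib sum_distrib_left)
    also have "\<dots> \<le> u * t + v * t'"
      using R uv by (intro add_mono mult_left_mono) (simp_all add: relax_quad)
    finally show ?thesis .
  qed
  have "relax (u *\<^sub>R t + v *\<^sub>R t') (u *\<^sub>R x + v *\<^sub>R x') (u *\<^sub>R z + v *\<^sub>R z') w'' r''"
    unfolding relax_def sum_r sum_w_scaleR sum_r_scaleR
  proof (intro conjI)
    show "\<forall>s. (\<Sum>a\<in>arcs. 2 * s a * w'' a - (s a)\<^sup>2 * r'' a) \<le> u *\<^sub>R t + v *\<^sub>R t'" using quad by simp
    show "\<forall>a\<in>arcs. 0 \<le> r'' a" using R uv by (simp add: relax_nonneg r''_def)
  qed (simp_all only: matrix_vector_right_distrib matrix_vector_mult_scaleR
      relax_x[OF R(1)] relax_x[OF R(2)] relax_z[OF R(1), symmetric] relax_z[OF R(2), symmetric]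
      relax_source[OF R(1)] relax_source[OF R(2)]
      relax_sink[OF R(1)] relax_sink[OF R(2)] uv(3) mult_1_right,
      simp add: relax_conservation[OF R(1)] relax_conservation[OF R(2)])
  then show "u *\<^sub>R p + v *\<^sub>R p' \<in> {(t, x, z). \<exists>w r. relax t x z w r}" by (auto simp: p)
qed

lemma relax_flow:
  assumes "relax t x z w r"
  shows "layered_flow arcs nodes tail (head \<psi>) layer CARD('n) r"
proof
  show "tail a \<in> nodes" "head \<psi> a \<in> nodes" "1 \<le> layer (tail a) \<and> layer (tail a) \<le> CARD('n)"
    if "a \<in> arcs" for a
    using that layer_nodes by (auto simp: dd_arcs_def intro: dd_nodes.step)
qed (use relax_conservation[OF assms] relax_source[OF assms] relax_nonneg[OF assms] in
    \<open>simp_all add: finite_dd_arcs finite_dd_nodes\<close>)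

text \<open>The bounds depend on \<open>t\<close> alone, which provides the compactness for
  \<open>closed_proj_R_set\<close>.\<close>

lemma relax_bound:
  assumes R: "relax t x z w r" and a: "a \<in> arcs"
  shows "\<bar>w a\<bar> \<le> t + 1" "\<bar>r a\<bar> \<le> 1"
proof -
  have r: "0 \<le> r a" "r a \<le> 1"
    using relax_nonneg[OF R a] layered_flow.r_le_1[OF relax_flow[OF R] a] by auto
  then show "\<bar>r a\<bar> \<le> 1" by simp
  have *: "2 * \<sigma> * w a - \<sigma>\<^sup>2 * r a \<le> t" for \<sigma>
  proof -
    have "(\<Sum>b\<in>arcs. 2 * (of_bool (b = a) * \<sigma>) * w b - (of_bool (b = a) * \<sigma>)\<^sup>2 * r b)
      = (\<Sum>b\<in>arcs. if b = a then 2 * \<sigma> * w b - \<sigma>\<^sup>2 * r b else 0)"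
      by (intro sum.cong) auto
    also have "\<dots> = 2 * \<sigma> * w a - \<sigma>\<^sup>2 * r a" using a by (simp add: finite_dd_arcs)
    finally show ?thesis using relax_quad[OF R, of "\<lambda>b. of_bool (b = a) * \<sigma>"] by simp
  qed
  \<comment> \<open>The parameters 1 and -1 give \<open>2 * \<bar>w a\<bar> \<le> t + r a\<close>,
    and 0 gives \<open>0 \<le> t\<close>.\<close>
  show "\<bar>w a\<bar> \<le> t + 1" using *[of 1] *[of "-1"] *[of 0] r by auto
qed

text \<open>A projection of a closed set need not be closed. Here \<open>t k\<close> converges and
  is therefore bounded, so by \<open>relax_bound\<close> the eliminated variables have a convergent
  subsequence, whose limit is a witness for the limit point.\<close>

lemma closed_proj_R_set: "closed {(t, x, z). \<exists>w r. relax t x z w r}"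
  unfolding closed_sequential_limits
proof (intro allI impI, elim conjE)
  fix p l assume p: "\<forall>k. p k \<in> {(t, x, z). \<exists>w r. relax t x z w r}" and lim: "p \<longlonglongrightarrow> l"
  define t x z where "t k = fst (p k)" and "x k = fst (snd (p k))" and "z k = snd (snd (p k))" for k
  obtain t' x' z' where l: "l = (t', x', z')" by (cases l) auto
  have lims: "t \<longlonglongrightarrow> t'" "x \<longlonglongrightarrow> x'" "z \<longlonglongrightarrow> z'"
    using tendsto_fst[OF lim] tendsto_fst[OF tendsto_snd[OF lim]] tendsto_snd[OF tendsto_snd[OF lim]]
    by (simp_all add: t_def[abs_def] x_def[abs_def] z_def[abs_def] l)
  have "\<forall>k. \<exists>w r. relax (t k) (x k) (z k) w r"
    using p by (auto simp: t_def x_def z_def split: prod.splits)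
  then obtain w r where R: "\<And>k. relax (t k) (x k) (z k) (w k) (r k)" by metis
  obtain B where B: "\<And>k. \<bar>t k\<bar> \<le> B"
    using convergent_imp_bounded[OF lims(1)] by (auto simp: bounded_iff)
  have "bounded (range (\<lambda>k. (w k a, r k a)))" if "a \<in> arcs" for a
  proof -
    have "norm (w k a, r k a) \<le> B + 2" for k
      using norm_Pair_le[of "w k a" "r k a"] relax_bound[OF R that, of k] B[of k] by auto
    then show ?thesis by (auto simp: bounded_iff)
  qed
  then obtain wr \<phi> where \<phi>: "strict_mono (\<phi> :: nat \<Rightarrow> nat)"
      and wr: "\<And>a. a \<in> arcs \<Longrightarrow> (\<lambda>k. (w (\<phi> k) a, r (\<phi> k) a)) \<longlonglongrightarrow> wr a"
    using bounded_coordinates_imp_convergent_subsequence[OF finite_dd_arcs, of F Z \<rho> \<psi> "\<lambda>k a. (w k a, r k a)"]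
    by blast
  define w' r' where "w' a = fst (wr a)" and "r' a = snd (wr a)" for a
  have lim_w: "(\<lambda>k. w (\<phi> k) a) \<longlonglongrightarrow> w' a" and lim_r: "(\<lambda>k. r (\<phi> k) a) \<longlonglongrightarrow> r' a" if "a \<in> arcs" for a
    using tendsto_fst[OF wr[OF that]] tendsto_snd[OF wr[OF that]] by (simp_all add: w'_def r'_def)
  have lims': "(\<lambda>k. t (\<phi> k)) \<longlonglongrightarrow> t'" "(\<lambda>k. x (\<phi> k)) \<longlonglongrightarrow> x'" "(\<lambda>k. z (\<phi> k)) \<longlonglongrightarrow> z'"
    using lims \<phi> by (auto intro: LIMSEQ_subseq_LIMSEQ[unfolded o_def])
  \<comment> \<open>Passes each equality constraint to the limit.\<close>
  have eq: "f' = g'" if "f \<longlonglongrightarrow> f'" "g \<longlonglongrightarrow> g'" "\<And>k. f k = g k" for f g :: "nat \<Rightarrow> 'c::t2_space" and f' g'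
  proof -
    have "f = g" using that(3) by (rule ext)
    then show ?thesis using that(1,2) LIMSEQ_unique by blast
  qed
  have sum_r: "(\<lambda>k. \<Sum>a\<in>{a\<in>arcs. P a}. r (\<phi> k) a) \<longlonglongrightarrow> (\<Sum>a\<in>{a\<in>arcs. P a}. r' a)" for P
    by (intro tendsto_sum lim_r) auto
  have "relax t' x' z' w' r'"
    unfolding relax_def
  proof (intro conjI allI ballI impI)
    fix s
    have "(\<lambda>k. \<Sum>a\<in>arcs. 2 * s a * w (\<phi> k) a - (s a)\<^sup>2 * r (\<phi> k) a)
        \<longlonglongrightarrow> (\<Sum>a\<in>arcs. 2 * s a * w' a - (s a)\<^sup>2 * r' a)"
      by (intro tendsto_intros lim_w lim_r)
    then show "(\<Sum>a\<in>arcs. 2 * s a * w' a - (s a)\<^sup>2 * r' a) \<le> t'"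
      by (rule LIMSEQ_le[OF _ lims'(1)]) (use relax_quad[OF R] in blast)
  next
    have "(\<lambda>k. transpose F *v x (\<phi> k)) \<longlonglongrightarrow> transpose F *v x'"
      by (intro bounded_linear.tendsto[OF matrix_vector_mul_bounded_linear] lims')
    moreover have "(\<lambda>k. \<Sum>a\<in>arcs. w (\<phi> k) a *\<^sub>R transition a) \<longlonglongrightarrow> (\<Sum>a\<in>arcs. w' a *\<^sub>R transition a)"
      by (intro tendsto_intros lim_w)
    ultimately show "transpose F *v x' = (\<Sum>a\<in>arcs. w' a *\<^sub>R transition a)"
      by (rule eq) (rule relax_x[OF R])
  next
    have "(\<lambda>k. \<Sum>a\<in>{a\<in>arcs. val a}. r (\<phi> k) a *\<^sub>R axis (index (layer (tail a))) (1::real))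
        \<longlonglongrightarrow> (\<Sum>a\<in>{a\<in>arcs. val a}. r' a *\<^sub>R axis (index (layer (tail a))) 1 :: (real, 'n) vec)"
      by (intro tendsto_intros lim_r) auto
    from lims'(3) this show "z' = (\<Sum>a\<in>{a\<in>arcs. val a}. r' a *\<^sub>R axis (index (layer (tail a))) 1)"
      by (rule eq) (rule relax_z[OF R])
  next
    fix N assume N: "N \<in> nodes" "2 \<le> layer N \<and> layer N \<le> CARD('n)"
    show "(\<Sum>a\<in>{a\<in>arcs. head \<psi> a = N}. r' a) = (\<Sum>a\<in>{a\<in>arcs. tail a = N}. r' a)"
      by (rule eq[OF sum_r sum_r]) (use relax_conservation[OF R] N in blast)
  next
    show "(\<Sum>a\<in>{a\<in>arcs. layer (tail a) = 1}. r' a) = 1"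
      by (rule eq[OF sum_r tendsto_const], rule relax_source[OF R])
    show "(\<Sum>a\<in>{a\<in>arcs. layer (tail a) = CARD('n)}. r' a) = 1"
      by (rule eq[OF sum_r tendsto_const], rule relax_sink[OF R])
  next
    fix a assume "a \<in> arcs"
    then show "0 \<le> r' a" using relax_nonneg[OF R] by (intro LIMSEQ_le_const[OF lim_r]) blast+
  qed
  then show "l \<in> {(t, x, z). \<exists>w r. relax t x z w r}" using l by auto
qed

subsection \<open>The relaxation contains the mixed-integer set\<close>

definition path_arc :: "bool list \<Rightarrow> nat \<Rightarrow> ('s, real^'m) dd_arc" where
  "path_arc v k = Arc (node (take k v)) (v ! k)"

lemma layer_tail_path_arc: "k < length v \<Longrightarrow> layer (tail (path_arc v k)) = Suc k"
  by (simp add: path_arc_def)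

lemma head_path_arc: "k < length v \<Longrightarrow> head \<psi> (path_arc v k) = node (take (Suc k) v)"
  by (simp add: path_arc_def take_Suc_conv_app_nth node_snoc)

lemma path_arc_in_arcs:
  assumes "feasible v" "k < length v"
  shows "path_arc v k \<in> arcs"
proof -
  have "feasible (take k v @ [v ! k])"
    using feasible_take[OF assms(1), of "Suc k"] assms(2) by (simp add: take_Suc_conv_app_nth)
  then show ?thesis by (auto simp: path_arc_def arcs_eq)
qed

text \<open>Expansion in the orthogonal transition vectors: by Pythagoras the squared norms of the
  terms add up to that of \<open>y\<close>.\<close>

lemma row_span_coefficients:
  assumes "length v \<le> CARD('n)" "y \<in> row_span v"
  shows "\<exists>c. y = (\<Sum>k<length v. c k *\<^sub>R transition (path_arc v k)) \<and>
    (\<Sum>k<length v. (c k)\<^sup>2) \<le> (norm y)\<^sup>2"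
  using assms
proof (induction v arbitrary: y rule: rev_induct)
  case Nil
  then show ?case by (simp add: row_span_def)
next
  case (snoc b v)
  define u where "u = transition (Arc (node v) b)"
  have lt: "length v < CARD('n)" using snoc.prems by simp
  have "y \<in> span (insert u (row_span v))"
    using snoc.prems(2) row_span_step[OF lt] by (simp add: u_def)
  then obtain d where "y - d *\<^sub>R u \<in> span (row_span v)" by (auto simp: span_insert)
  then have y0: "y - d *\<^sub>R u \<in> row_span v" by (simp add: row_span_def span_span)
  then obtain c where c: "y - d *\<^sub>R u = (\<Sum>k<length v. c k *\<^sub>R transition (path_arc v k))"
    "(\<Sum>k<length v. (c k)\<^sup>2) \<le> (norm (y - d *\<^sub>R u))\<^sup>2"
    using snoc.IH lt by fastforce
  \<comment> \<open>A zero transition vector gets coefficient 0, since \<open>d\<close> would then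
    be arbitrary and its square not covered by the norm of \<open>y\<close>.\<close>
  define c' where "c' = c(length v := if u = 0 then 0 else d)"
  have arc: "path_arc (v @ [b]) k = path_arc v k" if "k < length v" for k
    using that by (simp add: path_arc_def nth_append)
  have arc': "transition (path_arc (v @ [b]) (length v)) = u" by (simp add: path_arc_def u_def)
  have "y = (y - d *\<^sub>R u) + d *\<^sub>R u" by simp
  also have "\<dots> = (\<Sum>k<length (v @ [b]). c' k *\<^sub>R transition (path_arc (v @ [b]) k))"
    unfolding c(1) by (simp add: arc arc' c'_def)
  finally have "y = (\<Sum>k<length (v @ [b]). c' k *\<^sub>R transition (path_arc (v @ [b]) k))" .
  moreover have "(\<Sum>k<length (v @ [b]). (c' k)\<^sup>2) \<le> (norm y)\<^sup>2"
  proof -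
    have "u \<bullet> (y - d *\<^sub>R u) = 0" using transition_orthogonal[OF lt y0] by (simp add: u_def)
    then have "orthogonal (y - d *\<^sub>R u) (d *\<^sub>R u)" by (simp add: orthogonal_def inner_commute)
    from norm_add_Pythagorean[OF this] have "(norm y)\<^sup>2 = (norm (y - d *\<^sub>R u))\<^sup>2 + (norm (d *\<^sub>R u))\<^sup>2"
      by simp
    moreover have "(norm (d *\<^sub>R u))\<^sup>2 = (if u = 0 then 0 else d\<^sup>2)"
      using norm_transition[OF lt, of b] by (auto simp: u_def)
    moreover have "(\<Sum>k<length v. (c' k)\<^sup>2) = (\<Sum>k<length v. (c k)\<^sup>2)"
      by (intro sum.cong) (auto simp: c'_def)
    then have "(\<Sum>k<length (v @ [b]). (c' k)\<^sup>2) = (\<Sum>k<length v. (c k)\<^sup>2) + (if u = 0 then 0 else d\<^sup>2)"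
      by (simp add: c'_def)
    ultimately show ?thesis using c(2) by linarith
  qed
  ultimately show ?case by blast
qed

text \<open>The unit vectors on the support of \<open>indicator_vec v\<close> are mapped to the
  selected rows. This is the passage between spans along a complete path and vectors satisfying the
  complementarity constraint.\<close>

lemma row_span_full:
  assumes "length v = CARD('n)"
  shows "row_span v = (\<lambda>x. transpose F *v x) ` {x. \<forall>i. x $ i * (1 - indicator_vec v $ i) = 0}"
    (is "_ = ?f ` ?S")
proof
  have lin: "linear ?f" by (rule matrix_vector_mul_linear)
  have sub: "subspace ?S"
    by (rule subspace_coordinatewise_annihilator)
  show "row_span v \<subseteq> ?f ` ?S"
    unfolding row_span_def
  proof (rule span_minimal[OF _ linear_subspace_image[OF lin sub]], safe)
    fix k assume k: "k < length v" "v ! k"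
    have "indicator_vec v $ (index (Suc k) :: 'n) = 1" using k assms by (simp add: indicator_vec_nth)
    then have "axis (index (Suc k)) 1 \<in> ?S" by (auto simp: axis_def)
    moreover have "?f (axis (index (Suc k)) 1) = F $ index (Suc k)"
      by (simp add: transpose_mult_conv_sum axis_def if_distrib[of "\<lambda>c. c *\<^sub>R _"] del: transpose_matrix_vector cong: if_cong)
    ultimately show "F $ index (Suc k) \<in> ?f ` ?S" by (metis (no_types, lifting) image_eqI)
  qed
  show "?f ` ?S \<subseteq> row_span v"
  proof (rule image_subsetI)
    fix x assume x: "x \<in> ?S"
    have "x $ index (Suc k) *\<^sub>R F $ index (Suc k) \<in> row_span v" if k: "k < CARD('n)" for k
    proof (cases "v ! k")
      case True
      then show ?thesis using k assms unfolding row_span_def by (intro span_scale span_base) auto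
    next
      case False
      then have "x $ index (Suc k) = 0" using x indicator_vec_nth[OF assms k] by fastforce
      then show ?thesis using subspace_row_span by (simp add: subspace_0)
    qed
    then show "?f x \<in> row_span v"
      unfolding transpose_mult_conv_sum sum_UNIV_index by (intro subspace_sum subspace_row_span) auto
  qed
qed

lemma X_set_relax:
  assumes "(t, x, z) \<in> X_set F Z"
  shows "\<exists>w r. relax t x z w r"
proof -
  define y where "y = transpose F *v x"
  have z: "z \<in> Z" and x: "\<forall>i. x $ i * (1 - z $ i) = 0" and t: "(norm y)\<^sup>2 \<le> t"
    using assms unfolding X_set_def feasible_pairs_def y_def by auto
  obtain v where "coords z = map of_bool v" and len: "length v = CARD('n)"
    using bits_of_Z[OF z] .
  then have zv: "indicator_vec v = z" using indicator_vec_unique by blast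
  then have v: "feasible v" using feasible_full_iff[OF len] z by simp
  have "y \<in> row_span v" unfolding row_span_full[OF len] y_def zv using x by blast
  then obtain c where c: "y = (\<Sum>k<CARD('n). c k *\<^sub>R transition (path_arc v k))"
    "(\<Sum>k<CARD('n). (c k)\<^sup>2) \<le> (norm y)\<^sup>2"
    using row_span_coefficients[of v y] len by auto
  define P where "P = path_arc v"
  have lay: "layer (tail (P k)) = Suc k" if "k < CARD('n)" for k
    using that len by (simp add: P_def layer_tail_path_arc)
  \<comment> \<open>The arcs of a path lie in distinct layers.\<close>
  have inj: "inj_on P {..<CARD('n)}" by (rule inj_onI) (metis lay lessThan_iff nat.inject)
  have P_arcs: "P ` {..<CARD('n)} \<subseteq> arcs" using path_arc_in_arcs[OF v] len by (auto simp: P_def)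
  define r :: "('s, real^'m) dd_arc \<Rightarrow> real" where "r a = of_bool (a \<in> P ` {..<CARD('n)})" for a
  \<comment> \<open>The position of an arc on the path is recovered from its layer; positions start
    at 0 and layers at 1.\<close>
  define w where "w a = r a * c (layer (tail a) - 1)" for a
  have sum_P: "(\<Sum>a\<in>arcs. r a *\<^sub>R g a) = (\<Sum>k<CARD('n). g (P k))" for g :: "_ \<Rightarrow> 'c::real_vector"
    unfolding r_def by (rule sum_of_bool_image[OF finite_dd_arcs inj P_arcs])
  have sum_P_filter: "(\<Sum>a\<in>{a\<in>arcs. Q a}. r a) = (\<Sum>k<CARD('n). of_bool (Q (P k)))" for Q
  proof -
    have "(\<Sum>a\<in>{a\<in>arcs. Q a}. r a) = (\<Sum>a\<in>arcs. r a *\<^sub>R of_bool (Q a))"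
      by (rule sum.mono_neutral_cong_left) (auto simp: finite_dd_arcs)
    then show ?thesis by (simp only: sum_P)
  qed
  have "relax t x z w r"
    unfolding relax_def
  proof (intro conjI allI ballI impI)
    fix s
    have "(\<Sum>a\<in>arcs. 2 * s a * w a - (s a)\<^sup>2 * r a)
        = (\<Sum>a\<in>arcs. r a *\<^sub>R (2 * s a * c (layer (tail a) - 1) - (s a)\<^sup>2))"
      by (intro sum.cong) (auto simp: w_def algebra_simps)
    also have "\<dots> = (\<Sum>k<CARD('n). 2 * s (P k) * c k - (s (P k))\<^sup>2)"
      unfolding sum_P by (intro sum.cong) (auto simp: lay)
    also have "\<dots> \<le> (\<Sum>k<CARD('n). (c k)\<^sup>2)"
    proof (rule sum_mono)
      fix k
      show "2 * s (P k) * c k - (s (P k))\<^sup>2 \<le> (c k)\<^sup>2"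
        using zero_le_power2[of "c k - s (P k)"] by (simp add: power2_diff algebra_simps)
    qed
    finally show "(\<Sum>a\<in>arcs. 2 * s a * w a - (s a)\<^sup>2 * r a) \<le> t" using c(2) t by linarith
  next
    have "(\<Sum>a\<in>arcs. w a *\<^sub>R transition a) = (\<Sum>a\<in>arcs. r a *\<^sub>R (c (layer (tail a) - 1) *\<^sub>R transition a))"
      by (simp add: w_def)
    also have "\<dots> = y" unfolding sum_P c(1) by (intro sum.cong) (auto simp: lay P_def[symmetric])
    finally show "transpose F *v x = (\<Sum>a\<in>arcs. w a *\<^sub>R transition a)" by (simp only: y_def)
  next
    have "(\<Sum>a\<in>{a\<in>arcs. val a}. r a *\<^sub>R axis (index (layer (tail a))) 1)
        = (\<Sum>a\<in>arcs. r a *\<^sub>R (of_bool (val a) *\<^sub>R axis (index (layer (tail a))) (1::real) :: (real, 'n) vec))"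
      by (rule sum.mono_neutral_cong_left) (auto simp: finite_dd_arcs)
    also have "\<dots> = indicator_vec v"
      unfolding sum_P indicator_vec_def len by (intro sum.cong) (auto simp: lay, auto simp: P_def path_arc_def)
    finally show "z = (\<Sum>a\<in>{a\<in>arcs. val a}. r a *\<^sub>R axis (index (layer (tail a))) 1)" by (simp only: zv)
  next
    fix N assume N: "N \<in> nodes" "2 \<le> layer N \<and> layer N \<le> CARD('n)"
    \<comment> \<open>Inflow and outflow at \<open>N\<close> are sums of \<open>f\<close> shifted by
      one position. They agree because the path's two end nodes, in layers 1 and
      \<open>n + 1\<close>, are not \<open>N\<close>.\<close>
    define f :: "nat \<Rightarrow> real" where "f k = of_bool (node (take k v) = N)" for k
    have "f 0 = 0" "f (CARD('n)) = 0" using N len by (auto simp: f_def)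
    have "(\<Sum>a\<in>{a\<in>arcs. head \<psi> a = N}. r a) = (\<Sum>k<CARD('n). f (Suc k))"
      unfolding sum_P_filter by (intro sum.cong) (auto simp: P_def head_path_arc len f_def)
    also have "\<dots> = (\<Sum>k<CARD('n). f k)"
      using sum.lessThan_Suc_shift[of f "CARD('n)"] sum.lessThan_Suc[of f "CARD('n)"]
        \<open>f 0 = 0\<close> \<open>f (CARD('n)) = 0\<close> by simp
    also have "\<dots> = (\<Sum>a\<in>{a\<in>arcs. tail a = N}. r a)"
      unfolding sum_P_filter by (intro sum.cong) (auto simp: P_def path_arc_def f_def)
    finally show "(\<Sum>a\<in>{a\<in>arcs. head \<psi> a = N}. r a) = (\<Sum>a\<in>{a\<in>arcs. tail a = N}. r a)" .
  next
    have "(\<Sum>a\<in>{a\<in>arcs. layer (tail a) = Suc j}. r a) = 1" if "j < CARD('n)" for j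
    proof -
      have "(\<Sum>a\<in>{a\<in>arcs. layer (tail a) = Suc j}. r a) = (\<Sum>k<CARD('n). if k = j then 1 else 0)"
        unfolding sum_P_filter by (intro sum.cong) (auto simp: lay)
      then show ?thesis using that by simp
    qed
    from this[of 0] this[of "CARD('n) - 1"]
    show "(\<Sum>a\<in>{a\<in>arcs. layer (tail a) = 1}. r a) = 1"
      "(\<Sum>a\<in>{a\<in>arcs. layer (tail a) = CARD('n)}. r a) = 1" by simp_all
  qed (simp add: r_def)
  then show ?thesis by blast
qed

subsection \<open>Points of the relaxation as convex combinations\<close>

text \<open>Records for the paths into \<open>N\<close> an upper bound on the cost, the image
  \<open>y\<close> and the partial \<open>z\<close>. The image stands in for \<open>x\<close>
  because the relaxation constrains \<open>x\<close> only through it.\<close>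

definition path_points :: "('s, real^'m) dd_node \<Rightarrow> (real \<times> (real^'m) \<times> (real, 'n) vec) set" where
  "path_points N = {(t, y, indicator_vec v) |t y v.
    feasible v \<and> node v = N \<and> y \<in> row_span v \<and> (norm y)\<^sup>2 \<le> t}"

text \<open>The new transition vector is orthogonal to \<open>y\<close> and has norm at most 1, so
  the squared norm grows by at most the square of \<open>q\<close>, for every coefficient
  \<open>q\<close>.\<close>

lemma path_points_step:
  assumes a: "a \<in> arcs" and p: "p \<in> path_points (tail a)"
  shows "p + (q\<^sup>2, q *\<^sub>R transition a, of_bool (val a) *\<^sub>R axis (index (layer (tail a))) 1)
    \<in> path_points (head \<psi> a)"
proof -
  obtain t y v where p_eq: "p = (t, y, indicator_vec v)" and v: "feasible v" "node v = tail a"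
    and y: "y \<in> row_span v" "(norm y)\<^sup>2 \<le> t"
    using p by (auto simp: path_points_def)
  define b where "b = val a"
  have a_eq: "a = Arc (node v) b" using v by (cases a) (simp add: b_def)
  have vb: "feasible (v @ [b])" using a v(1) arc_feasible unfolding a_eq by blast
  have lt: "length v < CARD('n)" using feasible_length[OF vb] by simp
  have "y + q *\<^sub>R transition a \<in> row_span (v @ [b])"
    unfolding row_span_step[OF lt] a_eq using y(1) by (intro span_add span_scale) (auto intro: span_base)
  moreover have "(norm (y + q *\<^sub>R transition a))\<^sup>2 \<le> t + q\<^sup>2"
  proof -
    have "orthogonal y (q *\<^sub>R transition a)"
      using transition_orthogonal[OF lt y(1), of b] by (simp add: orthogonal_def a_eq inner_commute)
    from norm_add_Pythagorean[OF this]
    have "(norm (y + q *\<^sub>R transition a))\<^sup>2 = (norm y)\<^sup>2 + q\<^sup>2 * (norm (transition a))\<^sup>2"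
      by (simp add: power_mult_distrib)
    moreover have "q\<^sup>2 * (norm (transition a))\<^sup>2 \<le> q\<^sup>2"
      using norm_transition[OF lt, of b] by (auto simp: a_eq)
    ultimately show ?thesis using y(2) by linarith
  qed
  moreover have "head \<psi> a = node (v @ [b])" by (simp add: a_eq node_snoc)
  moreover have "indicator_vec v + of_bool (val a) *\<^sub>R axis (index (layer (tail a))) 1
      = (indicator_vec (v @ [b]) :: (real, 'n) vec)"
    by (simp add: indicator_vec_snoc a_eq)
  ultimately show ?thesis using vb unfolding path_points_def p_eq by auto
qed

text \<open>Only the image of \<open>x\<close> is controlled by the flow, so \<open>x\<close> itself
  is recovered up to the kernel of the transpose of \<open>F\<close>.\<close>

lemma relax_convex_hull:
  assumes R: "relax t x z w r"
  shows "\<exists>x'. (t, x', z) \<in> convex hull (X_set F Z) \<and> transpose F *v x' = transpose F *v x"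
proof -
  interpret flow: layered_flow arcs nodes tail "head \<psi>" layer "CARD('n)" r
    by (rule relax_flow[OF R])
  \<comment> \<open>Where \<open>r a = 0\<close> this is 0 by division by zero, which is consistent
    because then \<open>w a = 0\<close>.\<close>
  define q where "q a = w a / r a" for a
  define g where "g a = ((q a)\<^sup>2, q a *\<^sub>R transition a,
      of_bool (val a) *\<^sub>R axis (index (layer (tail a))) 1 :: (real, 'n) vec)" for a
  define \<Phi> where "\<Phi> = (\<lambda>(t :: real, x, z :: (real, 'n) vec). (t, transpose F *v x, z))"
  have "linear \<Phi>"
    unfolding \<Phi>_def
    by (rule linearI) (auto simp: matrix_vector_right_distrib matrix_vector_mult_scaleR
        simp del: transpose_matrix_vector)
  have "Z \<noteq> {}"
  proof
    assume "Z = {}"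
    then have "arcs = {}" unfolding arcs_eq feasible_iff by blast
    then show False using relax_source[OF R] by simp
  qed
  have "(\<Sum>a\<in>arcs. quad_over_lin (w a) (r a)) \<le> ereal t"
    by (intro sum_quad_over_lin_le_iff_linear[THEN iffD2] allI finite_dd_arcs relax_nonneg[OF R]
        relax_quad[OF R])
  then have "(\<forall>a\<in>arcs. r a = 0 \<longrightarrow> w a = 0) \<and> (\<Sum>a\<in>arcs. (w a)\<^sup>2 / r a) \<le> t"
    by (subst (asm) sum_quad_over_lin_le_iff) (simp_all add: finite_dd_arcs relax_nonneg[OF R])
  then have w0: "a \<in> arcs \<Longrightarrow> r a = 0 \<Longrightarrow> w a = 0" and le_t: "(\<Sum>a\<in>arcs. (w a)\<^sup>2 / r a) \<le> t" for a
    by blast+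
  have w: "r a * q a = w a" "r a * (q a)\<^sup>2 = (w a)\<^sup>2 / r a" if "a \<in> arcs" for a
    using w0[OF that] by (cases "r a = 0"; simp add: q_def power2_eq_square)+
  \<comment> \<open>The convex set attached to a node is the hull of its path points. Weighting the
    labels by \<open>r\<close> turns the ratios \<open>q\<close> back into \<open>w\<close> and
    their squares into the perspective terms.\<close>
  have "(\<Sum>a\<in>arcs. r a *\<^sub>R g a) \<in> \<Phi> ` (convex hull (X_set F Z))"
  proof (rule flow.flow_sum_in_convex)
    show "flow.L 1 = {node []}"
      using layer_1_nodes node_in_nodes feasible_Nil \<open>Z \<noteq> {}\<close> by (auto simp: flow.L_def)
    show "convex (convex hull (path_points N))" for N by (rule convex_convex_hull)
    show "convex hull (path_points N) \<noteq> {}" if N: "N \<in> nodes" for N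
    proof -
      obtain v where v: "feasible v" "N = node v" using nodes_cases[OF N \<open>Z \<noteq> {}\<close>] .
      then have "(0, 0, indicator_vec v) \<in> path_points N"
        using subspace_0[OF subspace_row_span] by (auto simp: path_points_def)
      then show ?thesis by auto
    qed
    have "(0, 0, indicator_vec []) \<in> path_points (node [])"
      unfolding path_points_def using subspace_0[OF subspace_row_span, of "[]"] feasible_Nil \<open>Z \<noteq> {}\<close>
      by (intro CollectI exI[of _ 0] exI[of _ "[]"]) simp
    then show "0 \<in> convex hull (path_points (node []))"
      by (intro hull_inc) (simp add: zero_prod_def indicator_vec_def)
    show "p + g a \<in> convex hull (path_points (head \<psi> a))"
      if a: "a \<in> arcs" and p: "p \<in> convex hull (path_points (tail a))" for a p
    proof -
      \<comment> \<open>Crossing \<open>a\<close> is a translation, which commutes with taking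
        convex hulls.\<close>
      have "(\<lambda>p. g a + p) ` path_points (tail a) \<subseteq> path_points (head \<psi> a)"
        using path_points_step[OF a] by (auto simp: g_def add.commute)
      then have "convex hull ((\<lambda>p. g a + p) ` path_points (tail a)) \<subseteq> convex hull (path_points (head \<psi> a))"
        by (rule hull_mono)
      then show ?thesis using p unfolding convex_hull_translation
        by (simp add: image_subset_iff add.commute)
    qed
    show "1 \<le> CARD('n)" by (simp add: Suc_leI)
    show "convex (\<Phi> ` (convex hull (X_set F Z)))"
      using \<open>linear \<Phi>\<close> by (intro convex_linear_image) auto
    show "convex hull (path_points N) \<subseteq> \<Phi> ` (convex hull (X_set F Z))"
      if N: "N \<in> nodes" "layer N = Suc (CARD('n))" for N
    proof -
      \<comment> \<open>Paths into the last layer are complete, so \<open>row_span_full\<close>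
        supplies a preimage \<open>x\<close> with the right support.\<close>
      have "path_points N \<subseteq> \<Phi> ` X_set F Z"
      proof
        fix p assume "p \<in> path_points N"
        then obtain t y v where p: "p = (t, y, indicator_vec v)" and v: "feasible v" "node v = N"
          and y: "y \<in> row_span v" "(norm y)\<^sup>2 \<le> t" by (auto simp: path_points_def)
        have len: "length v = CARD('n)" using N v(2) layer_node[of v] by simp
        obtain x where x: "y = transpose F *v x" "\<forall>i. x $ i * (1 - indicator_vec v $ i) = 0"
          using y(1) unfolding row_span_full[OF len] by blast
        have "(t, x, indicator_vec v) \<in> X_set F Z"
          unfolding X_set_def feasible_pairs_def using x y(2) v(1) feasible_full_iff[OF len] by blast
        then show "p \<in> \<Phi> ` X_set F Z" using p x(1) unfolding \<Phi>_def by (auto intro: rev_image_eqI)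
      qed
      then show ?thesis unfolding convex_hull_linear_image[OF \<open>linear \<Phi>\<close>] by (rule hull_mono)
    qed
  qed
  moreover have "(\<Sum>a\<in>arcs. r a *\<^sub>R g a) = (\<Sum>a\<in>arcs. (w a)\<^sup>2 / r a, transpose F *v x, z)"
  proof (intro prod_eqI)
    show "fst (\<Sum>a\<in>arcs. r a *\<^sub>R g a) = fst (\<Sum>a\<in>arcs. (w a)\<^sup>2 / r a, transpose F *v x, z)"
      using w by (simp add: fst_sum g_def)
    show "fst (snd (\<Sum>a\<in>arcs. r a *\<^sub>R g a)) = fst (snd (\<Sum>a\<in>arcs. (w a)\<^sup>2 / r a, transpose F *v x, z))"
      using w unfolding relax_x[OF R] by (simp add: fst_sum snd_sum g_def)
    have "z = (\<Sum>a\<in>arcs. r a *\<^sub>R (of_bool (val a) *\<^sub>R axis (index (layer (tail a))) 1))"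
      unfolding relax_z[OF R] by (rule sum.mono_neutral_cong_left) (auto simp: finite_dd_arcs)
    then show "snd (snd (\<Sum>a\<in>arcs. r a *\<^sub>R g a)) = snd (snd (\<Sum>a\<in>arcs. (w a)\<^sup>2 / r a, transpose F *v x, z))"
      by (simp add: snd_sum g_def)
  qed
  ultimately obtain x' where x': "((\<Sum>a\<in>arcs. (w a)\<^sup>2 / r a), x', z) \<in> convex hull (X_set F Z)"
      "transpose F *v x' = transpose F *v x"
    by (auto simp: \<Phi>_def simp del: transpose_matrix_vector)
  \<comment> \<open>The slack in the cost. \<open>X_set F Z\<close> is invariant under increasing
    its first component, hence so is its hull.\<close>
  define d where "d = t - (\<Sum>a\<in>arcs. (w a)\<^sup>2 / r a)"
  have "0 \<le> d" using le_t by (simp add: d_def)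
  then have "(+) (d, 0, 0) ` X_set F Z \<subseteq> X_set F Z" by (auto simp: X_set_def)
  then have "convex hull ((+) (d, 0, 0) ` X_set F Z) \<subseteq> convex hull (X_set F Z)" by (rule hull_mono)
  then have "(d, 0, 0) + ((\<Sum>a\<in>arcs. (w a)\<^sup>2 / r a), x', z) \<in> convex hull (X_set F Z)"
    using x'(1) unfolding convex_hull_translation by blast
  then show ?thesis using x'(2) by (auto simp: d_def)
qed

subsection \<open>Recession directions\<close>

text \<open>The vectors of the kernel with a feasible support form a union of subspaces,
  \<open>K\<close>. Let \<open>d\<close> be the component of \<open>k\<close> orthogonal to its
  span. On each support, \<open>d\<close> vanishes on the kernel, so its linear term is dominated by
  the quadratic one and the problem is bounded. By assumption \<open>d\<close> is then in the range
  of \<open>F\<close>, which is orthogonal to the kernel containing \<open>d\<close>; hence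
  \<open>d = 0\<close>.\<close>

lemma kernel_spanned:
  assumes bdd: "\<And>c d :: (real, 'n) vec.
      bdd_below ((\<lambda>(x, z). d \<bullet> x + c \<bullet> z + (norm (transpose F *v x))\<^sup>2) ` feasible_pairs Z)
        \<longleftrightarrow> (\<exists>\<delta>. F *v \<delta> = d)"
    and k: "transpose F *v k = 0"
  shows "k \<in> span {x. transpose F *v x = 0 \<and> (\<exists>z. (x, z) \<in> feasible_pairs Z)}"
proof -
  define K where "K = {x. transpose F *v x = 0 \<and> (\<exists>z. (x, z) \<in> feasible_pairs Z)}"
  obtain p d where p: "p \<in> span K" and d: "\<forall>x\<in>span K. orthogonal d x" and k_eq: "k = p + d"
    by (rule orthogonal_subspace_decomp_exists[of K k]) blast
  have "transpose F *v p = 0"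
  proof -
    have "subspace {x. transpose F *v x = 0}"
      by (auto simp: subspace_def matrix_vector_right_distrib matrix_vector_mult_scaleR
          simp del: transpose_matrix_vector)
    then show ?thesis using p span_minimal[of K "{x. transpose F *v x = 0}"] by (auto simp: K_def)
  qed
  then have Fd: "transpose F *v d = 0"
    using k unfolding k_eq matrix_vector_right_distrib by simp
  \<comment> \<open>Allows the lower bounds for the individual supports to be combined into a
    minimum.\<close>
  have "finite Z"
  proof (rule finite_subset)
    show "Z \<subseteq> indicator_vec ` {v :: bool list. set v \<subseteq> UNIV \<and> length v = CARD('n)}"
    proof
      fix z assume "z \<in> Z"
      then obtain v where "coords z = map of_bool v" "length v = CARD('n)" using bits_of_Z by blast
      then show "z \<in> indicator_vec ` {v :: bool list. set v \<subseteq> UNIV \<and> length v = CARD('n)}"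
        using indicator_vec_unique by (intro image_eqI[of _ _ v]) simp_all
    qed
    show "finite (indicator_vec ` {v :: bool list. set v \<subseteq> UNIV \<and> length v = CARD('n)} :: (real, 'n) vec set)"
      by (intro finite_imageI finite_lists_length_eq) simp
  qed
  have "\<exists>B. \<forall>x. (x, z) \<in> feasible_pairs Z \<longrightarrow> B \<le> d \<bullet> x + (norm (transpose F *v x))\<^sup>2" if "z \<in> Z" for z
  proof -
    define S where "S = {x :: (real, 'n) vec. \<forall>i. x $ i * (1 - z $ i) = 0}"
    have S: "(x, z) \<in> feasible_pairs Z \<longleftrightarrow> x \<in> S" for x
      using \<open>z \<in> Z\<close> by (auto simp: feasible_pairs_def S_def)
    have "subspace S" unfolding S_def by (rule subspace_coordinatewise_annihilator)
    \<comment> \<open>A linear right inverse on the support space. As \<open>x\<close> and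
      \<open>h y\<close> differ by an element of \<open>K\<close>, \<open>d\<close> takes the same
      value on both, and \<open>h\<close> is bounded.\<close>
    then obtain h where h: "range h \<subseteq> S" "linear h"
        "\<And>y. y \<in> (*v) (transpose F) ` S \<Longrightarrow> transpose F *v h y = y"
      using linear_exists_right_inverse_on[OF matrix_vector_mul_linear[of "transpose F"]]
      by blast
    obtain C where C: "\<And>y. norm (h y) \<le> norm y * C" "0 < C"
      using bounded_linear.pos_bounded[OF linear_conv_bounded_linear[THEN iffD1, OF h(2)]] by blast
    \<comment> \<open>The constant is the minimum over real \<open>s\<close> of the square of
      \<open>s\<close> minus \<open>norm d * C * s\<close>.\<close>
    have "- (norm d * C)\<^sup>2 / 4 \<le> d \<bullet> x + (norm (transpose F *v x))\<^sup>2" if x: "x \<in> S" for x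
    proof -
      define y where "y = transpose F *v x"
      have "transpose F *v (x - h y) = 0"
        using h(3)[of y] x unfolding y_def matrix_vector_mult_diff_distrib by simp
      moreover have "x - h y \<in> S" using h(1) x \<open>subspace S\<close> by (intro subspace_diff) auto
      ultimately have "x - h y \<in> K" using S by (auto simp: K_def)
      then have "d \<bullet> (x - h y) = 0" using d span_base by (auto simp: orthogonal_def)
      then have "d \<bullet> x = d \<bullet> h y" by (simp add: inner_diff_right)
      moreover have "\<bar>d \<bullet> h y\<bar> \<le> norm d * (norm y * C)"
        using Cauchy_Schwarz_ineq2[of d "h y"] C(1)[of y]
        by (meson mult_left_mono norm_ge_zero order_trans)
      moreover have "0 \<le> (norm y - norm d * C / 2)\<^sup>2" by simp
      then have "norm d * (norm y * C) \<le> (norm y)\<^sup>2 + (norm d * C)\<^sup>2 / 4"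
        by (simp add: power2_eq_square algebra_simps)
      ultimately show ?thesis unfolding y_def[symmetric] by linarith
    qed
    then show ?thesis using S by blast
  qed
  then have "\<forall>z\<in>Z. \<exists>B. \<forall>x. (x, z) \<in> feasible_pairs Z \<longrightarrow> B \<le> d \<bullet> x + (norm (transpose F *v x))\<^sup>2"
    by (rule ballI)
  from bchoice[OF this] obtain B
    where B: "\<forall>z\<in>Z. \<forall>x. (x, z) \<in> feasible_pairs Z \<longrightarrow> B z \<le> d \<bullet> x + (norm (transpose F *v x))\<^sup>2"
    by (rule exE)
  have "bdd_below ((\<lambda>(x, z). d \<bullet> x + 0 \<bullet> z + (norm (transpose F *v x))\<^sup>2) ` feasible_pairs Z)"
  proof (rule bdd_belowI2)
    fix p assume p: "p \<in> feasible_pairs Z"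
    then obtain x z where xz: "p = (x, z)" "z \<in> Z" by (auto simp: feasible_pairs_def)
    have "Min (B ` Z) \<le> B z" using \<open>finite Z\<close> xz by simp
    then show "Min (B ` Z) \<le> (\<lambda>(x, z). d \<bullet> x + 0 \<bullet> z + (norm (transpose F *v x))\<^sup>2) p"
      using B[rule_format, of z x] p xz by simp
  qed
  then obtain \<delta> where "F *v \<delta> = d" using bdd by blast
  \<comment> \<open>Moving \<open>F\<close> to the other side of the inner product produces the
    transpose applied to \<open>d\<close>, which is 0.\<close>
  then have "d \<bullet> d = d \<bullet> (F *v \<delta>)" by simp
  also have "\<dots> = (d v* F) \<bullet> \<delta>" by (simp add: dot_lmul_matrix)
  also have "\<dots> = 0" using Fd by simp
  finally have "k = p" using k_eq by simp
  then show ?thesis using p by (simp add: K_def)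
qed

text \<open>Arbitrarily large multiples of \<open>x\<close> paired with \<open>z\<close> have cost
  0. Giving the multiple \<open>inverse (e k)\<close> the weight \<open>e k\<close> leaves exactly
  \<open>x\<close>, while the contribution of \<open>z\<close> and the loss in \<open>p\<close>
  vanish in the limit.\<close>

lemma kernel_recession:
  assumes K: "transpose F *v x = 0" "(x, z) \<in> feasible_pairs Z"
    and p: "p \<in> closure (convex hull (X_set F Z))"
  shows "p + (0, x, 0) \<in> closure (convex hull (X_set F Z))" (is "_ \<in> ?C")
proof -
  define e :: "nat \<Rightarrow> real" where "e k = inverse (real (Suc k))" for k
  have e: "0 < e k" "e k \<le> 1" for k by (auto simp: e_def inverse_eq_divide)
  have "(0, inverse (e k) *\<^sub>R x, z) \<in> X_set F Z" for k
    using K by (auto simp: X_set_def feasible_pairs_def matrix_vector_mult_scaleR scaleR_vector_matrix_assoc)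
  then have q: "(0, inverse (e k) *\<^sub>R x, z) \<in> ?C" for k
    by (intro closure_subset[THEN subsetD] hull_inc)
  have "(1 - e k) *\<^sub>R p + e k *\<^sub>R (0, inverse (e k) *\<^sub>R x, z) \<in> ?C" for k
    using e[of k] by (intro convexD convex_closure convex_convex_hull p q) auto
  moreover have "(\<lambda>k. (1 - e k) *\<^sub>R p + e k *\<^sub>R (0, inverse (e k) *\<^sub>R x, z)) \<longlonglongrightarrow> p + (0, x, 0)"
  proof -
    have "(\<lambda>k. (1 - e k) *\<^sub>R p + (0, x, e k *\<^sub>R z)) \<longlonglongrightarrow> (1 - 0) *\<^sub>R p + (0, x, 0 *\<^sub>R z)"
      unfolding e_def by (intro tendsto_intros LIMSEQ_inverse_real_of_nat)
    moreover have "e k *\<^sub>R (0, inverse (e k) *\<^sub>R x, z) = (0, x, e k *\<^sub>R z)" for k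
      using e[of k] by simp
    ultimately show ?thesis by simp
  qed
  ultimately show ?thesis by (rule closed_sequentially[OF closed_closure])
qed

text \<open>Supported kernel vectors are closed under scaling by any real, so a linear combination
  can be added term by term.\<close>

lemma span_kernel_recession:
  assumes "x \<in> span {x. transpose F *v x = 0 \<and> (\<exists>z. (x, z) \<in> feasible_pairs Z)}"
    and "p \<in> closure (convex hull (X_set F Z))"
  shows "p + (0, x, 0) \<in> closure (convex hull (X_set F Z))"
  using assms
proof (induction arbitrary: p rule: span_induct_alt)
  case base
  then show ?case by (simp add: zero_prod_def[symmetric])
next
  case (step c x y)
  then obtain z where "transpose F *v x = 0" "(x, z) \<in> feasible_pairs Z" by blast
  then have "transpose F *v (c *\<^sub>R x) = 0" "(c *\<^sub>R x, z) \<in> feasible_pairs Z"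
    unfolding matrix_vector_mult_scaleR by (auto simp: feasible_pairs_def)
  from step.IH[OF kernel_recession[OF this step.prems]] show ?case by (simp add: add.assoc)
qed

end

theorem theorem1:
  fixes F :: "real^'m^'n::{finite,linorder}"
    and Z :: "(real^'n::{finite,linorder}) set"
    and \<rho> :: "nat \<Rightarrow> bool list \<Rightarrow> 's"
    and \<psi> :: "'s \<Rightarrow> bool \<Rightarrow> 's"
  assumes "Z \<subseteq> {z. \<forall>i. z $ i \<in> {0, 1}}"
    and "dp_representation Z \<rho> \<psi>"
    and "\<And>c d :: real^'n::{finite,linorder}.
           bdd_below ((\<lambda>(x, z). d \<bullet> x + c \<bullet> z + (norm (transpose F *v x))\<^sup>2) ` feasible_pairs Z)
             \<longleftrightarrow> (\<exists>\<delta>. F *v \<delta> = d)"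
  shows "closure (convex hull (X_set F Z)) = (\<lambda>(x0, x, z, w, r). (x0, x, z)) ` R_set F Z \<rho> \<psi>"
proof -
  interpret exact_diagram F Z \<rho> \<psi> using assms(1,2) by unfold_locales
  show ?thesis
    unfolding proj_R_set
  proof
    have "X_set F Z \<subseteq> {(t, x, z). \<exists>w r. relax t x z w r}" using X_set_relax by blast
    then show "closure (convex hull (X_set F Z)) \<subseteq> {(t, x, z). \<exists>w r. relax t x z w r}"
      by (intro closure_minimal hull_minimal convex_proj_R_set closed_proj_R_set)
  next
    show "{(t, x, z). \<exists>w r. relax t x z w r} \<subseteq> closure (convex hull (X_set F Z))"
    proof clarify
      fix t x z w r assume "relax t x z w r"
      then obtain x' where x': "(t, x', z) \<in> convex hull (X_set F Z)"
        "transpose F *v x' = transpose F *v x" using relax_convex_hull by blast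
      \<comment> \<open>The correction from \<open>x'\<close> to \<open>x\<close> lies in the
        kernel, hence is a recession direction of the closed hull.\<close>
      have "transpose F *v (x - x') = 0"
        using x'(2) unfolding matrix_vector_mult_diff_distrib by simp
      from span_kernel_recession[OF kernel_spanned[OF assms(3) this] closure_subset[THEN subsetD, OF x'(1)]]
      show "(t, x, z) \<in> closure (convex hull (X_set F Z))" by simp
    qed
  qed
qed

end
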